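(* Let $u$ be a normalized covering vector for $R(\mathbb{Z})$ with $\mathrm{nrm}(u)>3$. The Zariski closure of $\Gamma_u$ in $\mathrm{Isom}(\mathbb{H}^{\dim})\cong O^+(\dim,1)$ is all of $\mathrm{Isom}(\mathbb{H}^{\dim})$. Consequently, since $\Gamma_u$ has infinite co-volume, $\Gamma_u$ is a thin group.
   Context: Fix $\dim\in\{3,4,5\}$. If $\dim=3$, $R(\mathbb{Z})$ is the ring of integers of an imaginary quadratic field; if $\dim=4$, a maximal $\ddagger$-order of a rational definite quaternion algebra $\left(\frac{a,b}{\mathbb{Q}}\right)$ with orthogonal involution $(x+yi+zj+tij)^\ddagger=x+yi+zj-tij$; if $\dim=5$, a maximal order of a rational definite quaternion algebra. $\mathrm{nrm}(\alpha)=\alpha\bar\alpha$. $R(\mathbb{Z})^+$ is the $\ddagger$-fixed part if $\dim=4$ and $R(\mathbb{Z})$ otherwise; $R(\mathbb{R})^+=R(\mathbb{Z})^+\otimes\mathbb{R}$ is identified with Euclidean $\mathbb{R}^{\dim-1}$, the finite boundary of the upper half-space model of $\mathbb{H}^{\dim}$ (norm $\sqrt{\mathrm{nrm}}$, first coordinate the real part). For nonzero $u$, $S_u$ is the hyperplane through $0$ orthogonal to $u$, with interior the open half-space containing $u$. A nonzero $u$ with real part $0$ is a covering vector if open unit balls centered at the points of $S_u\cap R(\mathbb{Z})$ cover $S_u$; normalized if also $u\in R(\mathbb{Z})^+$ and $u/k\notin R(\mathbb{Z})$ for integers $k>1$. Choose $\tau\in R(\mathbb{Z})^+$ in the interior of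 $S_u$ such that $S_u\cap R(\mathbb{Z})^+$ and $\tau$ generate $R(\mathbb{Z})^+$. $\Gamma_u\subset\mathrm{Isom}(\mathbb{H}^{\dim})$ is generated by the translations $z\mapsto z+\omega$ for $\omega\in R(\mathbb{Z})^+\cap S_u$ and the inversions in unit spheres centered at points of $R(\mathbb{Z})^+\cap S_u$ and of $R(\mathbb{Z})^+\cap(S_u+\tau)$ (extended to $\mathbb{H}^{\dim}$). A thin group here means a discrete subgroup of infinite co-volume which is Zariski dense.
   Formalization: Infinite co-volume of Γ_u is a premise of the thinness claim, since it fails for some u (Hurwitz order, dim 5, u=2i+j+k, τ=j gives finite co-volume); Zariski density and discreteness are proved unconditionally. *)

theory Defs
  imports
    "HOL-Analysis.Analysis"
    "HOL-Algebra.Bij"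
    "HOL-Algebra.Generated_Groups"
    "HOL-Computational_Algebra.Polynomial"
    "HOL-Computational_Algebra.Group_Closure"
begin

section \<open>Real quaternions\<close>

text \<open>
  The pair \<open>(\<alpha>, \<beta>)\<close> stands for the Hamilton quaternion \<open>\<alpha> + \<beta> J\<close>, where \<open>I\<close> is the complex unit,
  \<open>J\<^sup>2 = -1\<close> and \<open>J \<alpha> = cnj \<alpha> J\<close>; thus \<open>x + y I + z J + t I J\<close> is \<open>(Complex x y, Complex z t)\<close>.
  The Euclidean structure is the library's one on the product \<open>complex \<times> complex\<close>; lemma
  \<open>norm_eq_sqrt_nrm\<close> shows that its norm is \<open>sqrt \<circ> nrm\<close>.
\<close>

type_synonym quat = "complex \<times> complex"

definition qone :: quat where
  "qone = (1, 0)"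

definition qmult :: "quat \<Rightarrow> quat \<Rightarrow> quat" where
  "qmult p q = (fst p * fst q - snd p * cnj (snd q), fst p * snd q + snd p * cnj (fst q))"

definition qcnj :: "quat \<Rightarrow> quat" where
  "qcnj q = (cnj (fst q), - snd q)"

definition qRe :: "quat \<Rightarrow> real" where
  "qRe q = Re (fst q)"

definition nrm :: "quat \<Rightarrow> real" where
  "nrm q = qRe (qmult q (qcnj q))"

lemma qmult_qcnj: "qmult q (qcnj q) = nrm q *\<^sub>R qone"
  by (simp add: nrm_def qRe_def qmult_def qcnj_def qone_def complex_eq_iff prod_eq_iff)

lemma norm_eq_sqrt_nrm: "norm (q :: quat) = sqrt (nrm q)"
  by (simp add: nrm_def qRe_def qmult_def qcnj_def norm_prod_def cmod_def power2_eq_square)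

text \<open>\<open>x + y I + z J + t I J \<mapsto> x + y I + z J - t I J\<close>\<close>

definition dagger :: "quat \<Rightarrow> quat" where
  "dagger q = (fst q, cnj (snd q))"


section \<open>The rings of integers\<close>

text \<open>The field \<open>\<rat>(sqrt (- d))\<close>, embedded in the complex numbers.\<close>

definition imag_quadratic_field :: "nat \<Rightarrow> complex set" where
  "imag_quadratic_field d = {Complex x (y * sqrt (real d)) | x y. x \<in> \<rat> \<and> y \<in> \<rat>}"

definition imag_quadratic_integers :: "nat \<Rightarrow> quat set" where
  "imag_quadratic_integers d = {(z, 0) | z. z \<in> imag_quadratic_field d \<and> algebraic_int z}"

text \<open>
  The rational quaternion algebra \<open>(a, b / \<rat>)\<close> for \<open>a, b < 0\<close>, embedded in the Hamilton quaternions by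
  \<open>i \<mapsto> sqrt (- a) I\<close>, \<open>j \<mapsto> sqrt (- b) J\<close>, hence \<open>i j \<mapsto> sqrt (a b) I J\<close>. Conjugation, norm and \<open>\<ddagger>\<close>
  of the algebra are the restrictions of \<open>qcnj\<close>, \<open>nrm\<close> and \<open>dagger\<close>.
\<close>

definition quat_algebra :: "rat \<Rightarrow> rat \<Rightarrow> quat set" where
  "quat_algebra a b =
     {(Complex x (y * sqrt (- of_rat a)), Complex (z * sqrt (- of_rat b)) (t * sqrt (of_rat (a * b))))
       | x y z t. x \<in> \<rat> \<and> y \<in> \<rat> \<and> z \<in> \<rat> \<and> t \<in> \<rat>}"

text \<open>An order: a unital subring that is a finitely generated abelian group and spans over \<open>\<rat>\<close>.\<close>

definition is_order :: "quat set \<Rightarrow> quat set \<Rightarrow> bool" where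
  "is_order A R \<longleftrightarrow>
     R \<subseteq> A \<and> qone \<in> R \<and> (\<forall>x\<in>R. \<forall>y\<in>R. qmult x y \<in> R) \<and>
     (\<exists>S. finite S \<and> R = group_closure S) \<and>
     (\<forall>x\<in>A. \<exists>m::nat. m > 0 \<and> real m *\<^sub>R x \<in> R)"

definition is_maximal_order :: "quat set \<Rightarrow> quat set \<Rightarrow> bool" where
  "is_maximal_order A R \<longleftrightarrow>
     is_order A R \<and> (\<forall>R'. is_order A R' \<and> R \<subseteq> R' \<longrightarrow> R' = R)"

definition is_dagger_order :: "quat set \<Rightarrow> quat set \<Rightarrow> bool" where
  "is_dagger_order A R \<longleftrightarrow> is_order A R \<and> dagger ` R = R"

text \<open>Maximal among the \<open>\<ddagger>\<close>-orders; such an order need not be a maximal order.\<close>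

definition is_maximal_dagger_order :: "quat set \<Rightarrow> quat set \<Rightarrow> bool" where
  "is_maximal_dagger_order A R \<longleftrightarrow>
     is_dagger_order A R \<and> (\<forall>R'. is_dagger_order A R' \<and> R \<subseteq> R' \<longrightarrow> R' = R)"

definition admissible_ring :: "nat \<Rightarrow> quat set \<Rightarrow> bool" where
  "admissible_ring n R \<longleftrightarrow>
     (n = 3 \<and> (\<exists>d>0. R = imag_quadratic_integers d)) \<or>
     (n = 4 \<and> (\<exists>a b. a < 0 \<and> b < 0 \<and> is_maximal_dagger_order (quat_algebra a b) R)) \<or>
     (n = 5 \<and> (\<exists>a b. a < 0 \<and> b < 0 \<and> is_maximal_order (quat_algebra a b) R))"

definition plus_part :: "nat \<Rightarrow> quat set \<Rightarrow> quat set" where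
  "plus_part n R = (if n = 4 then {x \<in> R. dagger x = x} else R)"

text \<open>\<open>R(\<real>)\<^sup>+ = R(\<int>)\<^sup>+ \<otimes> \<real>\<close>, as a real subspace of the Hamilton quaternions.\<close>

definition real_plus_part :: "nat \<Rightarrow> quat set \<Rightarrow> quat set" where
  "real_plus_part n R = span (plus_part n R)"


section \<open>Covering vectors\<close>

definition hyperplane :: "nat \<Rightarrow> quat set \<Rightarrow> quat \<Rightarrow> quat set" where
  "hyperplane n R u = {x \<in> real_plus_part n R. x \<bullet> u = 0}"

definition hyperplane_interior :: "nat \<Rightarrow> quat set \<Rightarrow> quat \<Rightarrow> quat set" where
  "hyperplane_interior n R u = {x \<in> real_plus_part n R. x \<bullet> u > 0}"

definition covering_vector :: "nat \<Rightarrow> quat set \<Rightarrow> quat \<Rightarrow> bool" where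
  "covering_vector n R u \<longleftrightarrow>
     u \<in> real_plus_part n R \<and> u \<noteq> 0 \<and> qRe u = 0 \<and>
     hyperplane n R u \<subseteq> (\<Union>c \<in> hyperplane n R u \<inter> R. ball c 1)"

definition normalized_covering_vector :: "nat \<Rightarrow> quat set \<Rightarrow> quat \<Rightarrow> bool" where
  "normalized_covering_vector n R u \<longleftrightarrow>
     covering_vector n R u \<and> u \<in> plus_part n R \<and>
     (\<forall>k::int. k > 1 \<longrightarrow> (1 / real_of_int k) *\<^sub>R u \<notin> R)"

definition complementary_vector :: "nat \<Rightarrow> quat set \<Rightarrow> quat \<Rightarrow> quat \<Rightarrow> bool" where
  "complementary_vector n R u \<tau> \<longleftrightarrow>
     \<tau> \<in> plus_part n R \<and> \<tau> \<in> hyperplane_interior n R u \<and>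
     group_closure (insert \<tau> (hyperplane n R u \<inter> plus_part n R)) = plus_part n R"


section \<open>Hyperbolic space and its isometry group\<close>

text \<open>
  The upper half-space model over the finite boundary \<open>'a\<close>; its dimension is \<open>DIM('a) + 1\<close>.
  Self-maps of the half-space are taken extensional (as in \<^theory>\<open>HOL-Algebra.Bij\<close>), so that equality
  of isometries is equality of functions.
\<close>

definition upper_half_space :: "('a::euclidean_space \<times> real) set" where
  "upper_half_space = {z. snd z > 0}"

definition hdist :: "'a::euclidean_space \<times> real \<Rightarrow> 'a \<times> real \<Rightarrow> real" where
  "hdist z w = arcosh (1 + (dist z w)\<^sup>2 / (2 * snd z * snd w))"

definition Isom :: "('a::euclidean_space \<times> real \<Rightarrow> 'a \<times> real) set" where
  "Isom = {f \<in> Bij upper_half_space.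
     \<forall>z\<in>upper_half_space. \<forall>w\<in>upper_half_space. hdist (f z) (f w) = hdist z w}"

definition Isom_group :: "('a::euclidean_space \<times> real \<Rightarrow> 'a \<times> real) monoid" where
  "Isom_group = (BijGroup upper_half_space)\<lparr>carrier := Isom\<rparr>"

definition translation :: "'a::euclidean_space \<Rightarrow> 'a \<times> real \<Rightarrow> 'a \<times> real" where
  "translation \<omega> = restrict (\<lambda>z. z + (\<omega>, 0)) upper_half_space"

text \<open>The inversion in the unit sphere centered at the boundary point \<open>c\<close>.\<close>

definition inversion :: "'a::euclidean_space \<Rightarrow> 'a \<times> real \<Rightarrow> 'a \<times> real" where
  "inversion c =
     restrict (\<lambda>z. (c, 0) + (1 / (dist z (c, 0))\<^sup>2) *\<^sub>R (z - (c, 0))) upper_half_space"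


section \<open>The isomorphism with \<open>O\<^sup>+(n, 1)\<close> and the Zariski topology\<close>

type_synonym 'a lorentz = "'a \<times> real \<times> real"

definition lorentz_form :: "'a::euclidean_space lorentz \<Rightarrow> 'a lorentz \<Rightarrow> real" where
  "lorentz_form v w =
     fst v \<bullet> fst w + fst (snd v) * fst (snd w) - snd (snd v) * snd (snd w)"

definition O_plus :: "('a::euclidean_space lorentz \<Rightarrow>\<^sub>L 'a lorentz) set" where
  "O_plus = {g. (\<forall>v w. lorentz_form (blinfun_apply g v) (blinfun_apply g w) = lorentz_form v w) \<and>
     (\<forall>v. lorentz_form v v = -1 \<and> snd (snd v) > 0 \<longrightarrow> snd (snd (blinfun_apply g v)) > 0)}"

text \<open>
  The standard isometry of the half-space model with the sheet
  \<open>lorentz_form v v = -1\<close>, \<open>snd (snd v) > 0\<close> of the hyperboloid: one has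
  \<open>cosh (hdist z w) = - lorentz_form (to_hyperboloid z) (to_hyperboloid w)\<close>.
\<close>

definition to_hyperboloid :: "'a::euclidean_space \<times> real \<Rightarrow> 'a lorentz" where
  "to_hyperboloid z =
     ((1 / snd z) *\<^sub>R fst z, ((norm z)\<^sup>2 - 1) / (2 * snd z), ((norm z)\<^sup>2 + 1) / (2 * snd z))"

text \<open>
  The isomorphism from \<open>Isom\<close> to \<open>O_plus\<close>: the unique Lorentz transformation that induces the
  given isometry on the hyperboloid.
\<close>

definition lorentz_rep ::
    "('a::euclidean_space \<times> real \<Rightarrow> 'a \<times> real) \<Rightarrow> ('a lorentz \<Rightarrow>\<^sub>L 'a lorentz)" where
  "lorentz_rep f = (THE g. g \<in> O_plus \<and>
     (\<forall>z\<in>upper_half_space. to_hyperboloid (f z) = blinfun_apply g (to_hyperboloid z)))"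

text \<open>
  On the finite-dimensional space of endomorphisms, \<open>real_polynomial_function\<close> describes exactly the
  polynomials in the matrix entries.
\<close>

definition zariski_closed :: "('a::euclidean_space \<times> real \<Rightarrow> 'a \<times> real) set \<Rightarrow> bool" where
  "zariski_closed C \<longleftrightarrow>
     (\<exists>P \<subseteq> Collect real_polynomial_function. C = {f \<in> Isom. \<forall>p\<in>P. p (lorentz_rep f) = 0})"

definition zariski_closure ::
    "('a::euclidean_space \<times> real \<Rightarrow> 'a \<times> real) set \<Rightarrow> ('a \<times> real \<Rightarrow> 'a \<times> real) set" where
  "zariski_closure X = \<Inter>{C. zariski_closed C \<and> X \<subseteq> C}"


section \<open>Thin groups\<close>

text \<open>The topology of \<open>Isom\<close> is the one of the Lie group \<open>O_plus\<close>.\<close>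

definition discrete_subgroup :: "('a::euclidean_space \<times> real \<Rightarrow> 'a \<times> real) set \<Rightarrow> bool" where
  "discrete_subgroup \<Gamma> \<longleftrightarrow> subgroup \<Gamma> Isom_group \<and> discrete (lorentz_rep ` \<Gamma>)"

definition hyperbolic_volume :: "('a::euclidean_space \<times> real) measure" where
  "hyperbolic_volume = density lborel
     (\<lambda>z. ennreal (indicator upper_half_space z / snd z ^ DIM('a \<times> real)))"

definition fundamental_domain ::
    "('a::euclidean_space \<times> real \<Rightarrow> 'a \<times> real) set \<Rightarrow> ('a \<times> real) set \<Rightarrow> bool" where
  "fundamental_domain \<Gamma> F \<longleftrightarrow>
     F \<subseteq> upper_half_space \<and> F \<in> sets borel \<and>
     negligible (upper_half_space - (\<Union>\<gamma>\<in>\<Gamma>. \<gamma> ` F)) \<and>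
     (\<forall>\<gamma>\<in>\<Gamma>. \<gamma> \<noteq> \<one>\<^bsub>Isom_group\<^esub> \<longrightarrow> negligible (\<gamma> ` F \<inter> F))"

text \<open>All fundamental domains of a discrete group have the same volume, the co-volume of the group.\<close>

definition infinite_covolume :: "('a::euclidean_space \<times> real \<Rightarrow> 'a \<times> real) set \<Rightarrow> bool" where
  "infinite_covolume \<Gamma> \<longleftrightarrow>
     (\<exists>F. fundamental_domain \<Gamma> F) \<and>
     (\<forall>F. fundamental_domain \<Gamma> F \<longrightarrow> emeasure hyperbolic_volume F = \<infinity>)"

definition thin_group :: "('a::euclidean_space \<times> real \<Rightarrow> 'a \<times> real) set \<Rightarrow> bool" where
  "thin_group \<Gamma> \<longleftrightarrow>
     discrete_subgroup \<Gamma> \<and> infinite_covolume \<Gamma> \<and> zariski_closure \<Gamma> = Isom"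


section \<open>The group \<open>\<Gamma>\<^sub>u\<close>\<close>

text \<open>A linear isometry \<open>\<iota>\<close> that identifies the Euclidean space \<open>'a\<close> with \<open>R(\<real>)\<^sup>+\<close>.\<close>

definition boundary_identification ::
    "nat \<Rightarrow> quat set \<Rightarrow> ('a::euclidean_space \<Rightarrow> quat) \<Rightarrow> bool" where
  "boundary_identification n R \<iota> \<longleftrightarrow>
     linear \<iota> \<and> (\<forall>x. norm x = sqrt (nrm (\<iota> x))) \<and> range \<iota> = real_plus_part n R"

definition Gamma_u_generators ::
    "nat \<Rightarrow> quat set \<Rightarrow> ('a::euclidean_space \<Rightarrow> quat) \<Rightarrow> quat \<Rightarrow> quat \<Rightarrow>
     ('a \<times> real \<Rightarrow> 'a \<times> real) set" where
  "Gamma_u_generators n R \<iota> u \<tau> =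
     {translation \<omega> | \<omega>. \<iota> \<omega> \<in> plus_part n R \<inter> hyperplane n R u} \<union>
     {inversion c | c. \<iota> c \<in> plus_part n R \<inter> hyperplane n R u} \<union>
     {inversion c | c. \<iota> c \<in> plus_part n R \<inter> (\<lambda>x. x + \<tau>) ` hyperplane n R u}"

definition Gamma_u ::
    "nat \<Rightarrow> quat set \<Rightarrow> ('a::euclidean_space \<Rightarrow> quat) \<Rightarrow> quat \<Rightarrow> quat \<Rightarrow>
     ('a \<times> real \<Rightarrow> 'a \<times> real) set" where
  "Gamma_u n R \<iota> u \<tau> = generate Isom_group (Gamma_u_generators n R \<iota> u \<tau>)"

end

theory Submission
  imports Defs
begin

text \<open>
  In light-cone coordinates, \<open>\<Gamma>\<^sub>u\<close> preserves the
  lattice \<open>R(\<int>)\<^sup>+ \<oplus> \<int> \<oplus> \<int>\<close>, because norms on \<open>R(\<int>)\<close> are integral; hence it is discrete.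

  The Zariski closure \<open>G\<close> contains the translations along the whole real hyperplane \<open>S\<^sub>u\<close>: they are
  unipotent, so a polynomial that vanishes on the powers of one of them vanishes on its one-parameter
  group. Conjugating by them, \<open>G\<close> contains the inversions in all unit spheres centered on \<open>S\<^sub>u\<close> and
  on \<open>S\<^sub>u + \<tau>\<close>. Inverting these spheres in each other yields every sphere. So \<open>G\<close> contains
  all reflections, and reflections generate \<open>O\<^sup>+(n, 1)\<close>.
\<close>

text \<open>The closure is computed as \<open>polynomial_hull\<close> in the vector space of
  endomorphisms, where composition with a fixed factor is linear. This makes the hull a semigroup,
  and as reflections are involutions and translations invert to translations, that is enough to
  conjugate. Modulo translations along the hyperplane, a sphere is determined by its height and
  radius, so reaching all spheres is a problem about two real parameters (\<open>heights\<close>).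
  It is solvable because of a free direction inside the hyperplane: two unit spheres of given
  heights can be placed at any sufficiently large distance. The quaternion 1 supplies this
  direction, as \<open>u\<close> has real part 0. Positive dilations never change the sign of a
  height, so one explicit inversion has to cross the hyperplane. Norms are integral because the
  powers of a ring element have bounded denominators; this treats quadratic integers and quaternion
  orders alike.\<close>

section \<open>Integrality of the norm\<close>

text \<open>In lowest terms \<open>q ^ k\<close> has denominator \<open>n ^ k\<close>, which must
  divide \<open>D\<close>. The exponent \<open>k = D\<close> already decides, because
  \<open>D < 2 ^ D\<close>.\<close>

lemma Rats_imp_Ints_if_powers_bounded_denominator:
  fixes q :: real
  assumes "q \<in> \<rat>" "D > (0::nat)" and powers: "\<And>k. real D * q ^ k \<in> \<int>"
  shows "q \<in> \<int>"
proof -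
  obtain m n :: nat where n: "n \<noteq> 0" and q: "\<bar>q\<bar> = real m / real n" and "coprime m n"
    using Rats_abs_nat_div_natE[OF assms(1)] by metis
  have "n ^ D dvd D"
  proof -
    have "\<bar>real D * q ^ D\<bar> \<in> \<int>"
      using powers Ints_abs by blast
    then obtain j :: int where j: "real D * \<bar>q\<bar> ^ D = of_int j"
      by (auto simp: abs_mult power_abs elim!: Ints_cases)
    have "real (D * m ^ D) = of_int j * real (n ^ D)"
      using j n by (simp add: q field_simps)
    then have "int (D * m ^ D) = j * int (n ^ D)"
      by (metis (mono_tags, opaque_lifting) of_int_eq_iff of_int_mult of_int_of_nat_eq)
    then have "n ^ D dvd D * m ^ D"
      by (metis dvd_triv_right int_dvd_int_iff)
    moreover have "coprime (n ^ D) (m ^ D)"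
      using \<open>coprime m n\<close> by (simp add: coprime_commute)
    ultimately show ?thesis
      using coprime_dvd_mult_left_iff by blast
  qed
  then have "n ^ D \<le> D"
    using assms(2) by (simp add: dvd_imp_le)
  moreover have "D < 2 ^ D"
    by simp
  moreover have "2 ^ D \<le> n ^ D" if "n \<ge> 2"
    using that by (simp add: power_mono)
  ultimately have "n = 1"
    using n by linarith
  then show ?thesis
    using q by (auto simp: abs_if split: if_splits) (metis Ints_minus Ints_of_nat minus_minus)
qed

text \<open>By bilinearity, a common denominator for the finitely many products of generators serves
  the whole group.\<close>

lemma inner_group_closure_common_denominator:
  fixes S :: "'v::real_inner set"
  assumes "finite S" and rat: "\<And>s t. s \<in> S \<Longrightarrow> t \<in> S \<Longrightarrow> s \<bullet> t \<in> \<rat>"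
  obtains D :: nat where "D > 0"
    "\<And>x y. x \<in> group_closure S \<Longrightarrow> y \<in> group_closure S \<Longrightarrow> real D * (x \<bullet> y) \<in> \<int>"
proof -
  have "\<exists>D::nat. D > 0 \<and> (\<forall>x\<in>T. real D * x \<in> \<int>)" if "finite T" "T \<subseteq> \<rat>" for T :: "real set"
    using that
  proof (induction T)
    case empty
    then show ?case by auto
  next
    case (insert q T)
    then obtain D :: nat where D: "D > 0" "\<forall>x\<in>T. real D * x \<in> \<int>"
      by auto
    obtain a b :: int where b: "b > 0" and q: "q = of_int a / of_int b"
      using insert.prems by (auto elim: Rats_cases')
    have "real (nat b * D) * q = real D * of_int a"
      using b by (simp add: q)
    then have "real (nat b * D) * q \<in> \<int>"
      by (metis Ints_mult Ints_of_int Ints_of_nat)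
    moreover have "real (nat b * D) * x \<in> \<int>" if "x \<in> T" for x
      using D(2) that by (metis Ints_mult Ints_of_nat mult.assoc of_nat_mult)
    ultimately show ?case
      using b D(1) by (intro exI[of _ "nat b * D"]) auto
  qed
  from this[of "(\<lambda>(s, t). s \<bullet> t) ` (S \<times> S)"] obtain D :: nat
    where D: "D > 0" "\<And>s t. s \<in> S \<Longrightarrow> t \<in> S \<Longrightarrow> real D * (s \<bullet> t) \<in> \<int>"
    using assms by fastforce
  have 1: "real D * (x \<bullet> t) \<in> \<int>" if "x \<in> group_closure S" "t \<in> S" for x t
    using that(1)
    by induction (use D(2) that(2) in \<open>auto simp: inner_diff_left right_diff_distrib\<close>)
  have "real D * (x \<bullet> y) \<in> \<int>" if "x \<in> group_closure S" "y \<in> group_closure S" for x y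
    using that(2)
    by induction (use 1 that(1) in \<open>auto simp: inner_diff_right right_diff_distrib\<close>)
  with D(1) that show thesis by blast
qed

section \<open>Norms on quaternion orders\<close>

lemma nrm_eq_inner: "nrm x = x \<bullet> x"
  using norm_eq_sqrt_nrm[of x] by (simp add: norm_eq_sqrt_inner)

lemma nrm_qmult: "nrm (qmult x y) = nrm x * nrm y"
  by (simp add: nrm_def qRe_def qmult_def qcnj_def) algebra

lemma inner_quat_algebra_Rats:
  assumes "a < 0" "b < 0" "x \<in> quat_algebra a b" "y \<in> quat_algebra a b"
  shows "x \<bullet> y \<in> \<rat>"
proof -
  define A B C where "A = sqrt (- of_rat a)" and "B = sqrt (- of_rat b)" and "C = sqrt (of_rat (a * b))"
  have "A * A = - of_rat a" "B * B = - of_rat b" "C * C = of_rat (a * b)"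
    using assms(1,2) by (auto simp: A_def B_def C_def mult_nonpos_nonpos of_rat_minus)
  then have rat: "A * A \<in> \<rat>" "B * B \<in> \<rat>" "C * C \<in> \<rat>"
    by auto
  from assms(3,4) obtain x1 x2 x3 x4 y1 y2 y3 y4 where
    "x = (Complex x1 (x2 * A), Complex (x3 * B) (x4 * C))"
    "y = (Complex y1 (y2 * A), Complex (y3 * B) (y4 * C))" and
    rats: "x1 \<in> \<rat>" "x2 \<in> \<rat>" "x3 \<in> \<rat>" "x4 \<in> \<rat>" "y1 \<in> \<rat>" "y2 \<in> \<rat>" "y3 \<in> \<rat>" "y4 \<in> \<rat>"
    unfolding quat_algebra_def A_def B_def C_def by blast
  then have "x \<bullet> y = x1 * y1 + x2 * y2 * (A * A) + x3 * y3 * (B * B) + x4 * y4 * (C * C)"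
    by (simp add: inner_complex_def)
  then show ?thesis
    using rats rat by (auto intro!: Rats_add Rats_mult)
qed

text \<open>The powers of \<open>x\<close> stay in the finitely generated group \<open>R\<close>, so
  their norms, which are the powers of \<open>nrm x\<close>, have a common denominator.\<close>

lemma nrm_order_Ints:
  assumes "a < 0" "b < 0" "is_order (quat_algebra a b) R" "x \<in> R"
  shows "nrm x \<in> \<int>"
proof -
  obtain S where S: "finite S" "R = group_closure S" and R: "R \<subseteq> quat_algebra a b"
    "qone \<in> R" "\<And>x y. x \<in> R \<Longrightarrow> y \<in> R \<Longrightarrow> qmult x y \<in> R"
    using assms(3) unfolding is_order_def by blast
  have rat: "s \<bullet> t \<in> \<rat>" if "s \<in> R" "t \<in> R" for s t
    using inner_quat_algebra_Rats[OF assms(1,2)] that R(1) by blast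
  have "S \<subseteq> R"
    using S(2) by (auto intro: group_closure.base)
  with rat obtain D :: nat where D: "D > 0" "\<And>x y. x \<in> R \<Longrightarrow> y \<in> R \<Longrightarrow> real D * (x \<bullet> y) \<in> \<int>"
    using inner_group_closure_common_denominator[of S] S by (metis subsetD)
  have "(qmult x ^^ k) qone \<in> R \<and> nrm ((qmult x ^^ k) qone) = nrm x ^ k" for k
    using R(2,3) assms(4)
    by (induction k) (auto simp: nrm_qmult, simp add: nrm_def qmult_def qcnj_def qone_def qRe_def)
  then have "real D * nrm x ^ k \<in> \<int>" for k
    using D(2) by (metis nrm_eq_inner)
  moreover have "nrm x \<in> \<rat>"
    using rat assms(4) by (simp add: nrm_eq_inner)
  ultimately show ?thesis
    using Rats_imp_Ints_if_powers_bounded_denominator D(1) by blast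
qed

section \<open>Norms on imaginary quadratic integers\<close>

lemma group_closure_of_int_mult:
  fixes s :: "'v::comm_ring_1"
  assumes "c \<in> \<int>" "s \<in> group_closure S"
  shows "c * s \<in> group_closure S"
proof -
  obtain i where i: "c = of_int i"
    using assms(1) by (auto elim: Ints_cases)
  show ?thesis
    using group_closure_scalar_mult_left[OF assms(2), of "nat \<bar>i\<bar>"]
    by (cases "i \<ge> 0") (simp_all add: i minus_mult_left[symmetric])
qed

text \<open>A monic integral equation of degree \<open>m\<close> rewrites \<open>z ^ k\<close> for
  \<open>k \<ge> m\<close> in lower powers. The resulting finite generation of the ring generated by
  one element replaces that of an order, since the quadratic integers are given elementwise.\<close>

lemma power_algebraic_int_group_closure:
  fixes z :: "'v::field"
  assumes "algebraic_int z"
  obtains m where "\<And>k. z ^ k \<in> group_closure ((\<lambda>i. z ^ i) ` {..<m})"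
proof -
  obtain p where p: "lead_coeff p = 1" "\<And>i. coeff p i \<in> \<int>" "poly p z = 0"
    using assms by (auto elim: algebraic_int.cases)
  define m where "m = degree p"
  let ?M = "group_closure ((\<lambda>i. z ^ i) ` {..<m})"
  have sum: "sum f A \<in> ?M" if "\<And>i. i \<in> A \<Longrightarrow> f i \<in> ?M" for f and A :: "nat set"
    using that by (induction A rule: infinite_finite_induct) (auto intro: group_closure_add)
  have "z ^ k \<in> ?M" for k
  proof (induction k rule: less_induct)
    case (less k)
    show ?case
    proof (cases "k < m")
      case True
      then show ?thesis
        by (auto intro: group_closure.base)
    next
      case False
      have "0 = z ^ (k - m) * poly p z"
        using p(3) by simp
      also have "\<dots> = z ^ (k - m) * ((\<Sum>i<m. coeff p i * z ^ i) + z ^ m)"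
        using p(1) by (simp add: poly_altdef m_def lessThan_Suc_atMost[symmetric])
      also have "\<dots> = (\<Sum>i<m. coeff p i * z ^ (k - m + i)) + z ^ k"
      proof -
        have "z ^ (k - m) * z ^ m = z ^ k"
          using False by (simp add: power_add[symmetric])
        then show ?thesis
          unfolding distrib_left sum_distrib_left power_add by (simp add: mult_ac)
      qed
      finally have "z ^ k = - (\<Sum>i<m. coeff p i * z ^ (k - m + i))"
        by (simp add: eq_neg_iff_add_eq_0 add.commute)
      moreover have "(\<Sum>i<m. coeff p i * z ^ (k - m + i)) \<in> ?M"
        by (intro sum group_closure_of_int_mult p(2) less) (use False in auto)
      ultimately show ?thesis
        by simp
    qed
  qed
  then show thesis
    using that by blast
qed

lemma imag_quadratic_field_mult:
  assumes "z \<in> imag_quadratic_field d" "w \<in> imag_quadratic_field d"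
  shows "z * w \<in> imag_quadratic_field d"
proof -
  obtain x y x' y' where zw: "z = Complex x (y * sqrt (real d))" "w = Complex x' (y' * sqrt (real d))"
    and r: "x \<in> \<rat>" "y \<in> \<rat>" "x' \<in> \<rat>" "y' \<in> \<rat>"
    using assms unfolding imag_quadratic_field_def by blast
  have "sqrt (real d) * sqrt (real d) = real d"
    by simp
  then have "z * w = Complex (x * x' - y * y' * real d) ((x * y' + y * x') * sqrt (real d))"
    by (simp add: zw complex_eq_iff algebra_simps)
  moreover have "x * x' - y * y' * real d \<in> \<rat>" "x * y' + y * x' \<in> \<rat>"
    using r by auto
  ultimately show ?thesis
    unfolding imag_quadratic_field_def by blast
qed

lemma imag_quadratic_field_power:
  assumes "z \<in> imag_quadratic_field d"
  shows "z ^ k \<in> imag_quadratic_field d"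
proof (induction k)
  case 0
  have "z ^ 0 = Complex 1 (0 * sqrt (real d))"
    by (simp add: complex_eq_iff)
  then show ?case
    unfolding imag_quadratic_field_def using Rats_0 Rats_1 by blast
qed (simp add: assms imag_quadratic_field_mult)

lemma inner_imag_quadratic_field_Rats:
  assumes "z \<in> imag_quadratic_field d" "w \<in> imag_quadratic_field d"
  shows "z \<bullet> w \<in> \<rat>"
proof -
  obtain x y x' y' where zw: "z = Complex x (y * sqrt (real d))" "w = Complex x' (y' * sqrt (real d))"
    and r: "x \<in> \<rat>" "y \<in> \<rat>" "x' \<in> \<rat>" "y' \<in> \<rat>"
    using assms unfolding imag_quadratic_field_def by blast
  have "sqrt (real d) * sqrt (real d) = real d"
    by simp
  then have "z \<bullet> w = x * x' + y * y' * real d"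
    by (simp add: zw inner_complex_def algebra_simps)
  then show ?thesis
    using r by auto
qed

lemma nrm_imag_quadratic_integers_Ints:
  assumes "x \<in> imag_quadratic_integers d"
  shows "nrm x \<in> \<int>"
proof -
  obtain z where x: "x = (z, 0)" and z: "z \<in> imag_quadratic_field d" "algebraic_int z"
    using assms unfolding imag_quadratic_integers_def by blast
  obtain m where m: "\<And>k. z ^ k \<in> group_closure ((\<lambda>i. z ^ i) ` {..<m})"
    using power_algebraic_int_group_closure[OF z(2)] by blast
  obtain D :: nat where D: "D > 0" "\<And>v w. v \<in> group_closure ((\<lambda>i. z ^ i) ` {..<m}) \<Longrightarrow>
      w \<in> group_closure ((\<lambda>i. z ^ i) ` {..<m}) \<Longrightarrow> real D * (v \<bullet> w) \<in> \<int>"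
    by (rule inner_group_closure_common_denominator[of "(\<lambda>i. z ^ i) ` {..<m}"])
      (auto intro: inner_imag_quadratic_field_Rats imag_quadratic_field_power z(1))
  have "nrm x = z \<bullet> z"
    by (simp add: x nrm_eq_inner)
  moreover have "(z \<bullet> z) ^ k = z ^ k \<bullet> z ^ k" for k
    by (simp add: power2_norm_eq_inner[symmetric] norm_power power_mult[symmetric] mult.commute)
  ultimately have "real D * nrm x ^ k \<in> \<int>" for k
    using D(2)[OF m m, of k k] by simp
  moreover have "nrm x \<in> \<rat>"
    using \<open>nrm x = z \<bullet> z\<close> inner_imag_quadratic_field_Rats[OF z(1) z(1)] by simp
  ultimately show ?thesis
    using Rats_imp_Ints_if_powers_bounded_denominator D(1) by blast
qed

lemma plus_part_subset: "plus_part n R \<subseteq> R"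
  by (auto simp: plus_part_def)

lemma nrm_admissible_ring_Ints:
  assumes "admissible_ring n R" "x \<in> R"
  shows "nrm x \<in> \<int>"
  using assms nrm_imag_quadratic_integers_Ints nrm_order_Ints
  unfolding admissible_ring_def is_maximal_order_def is_maximal_dagger_order_def is_dagger_order_def
  by blast

text \<open>This element will be the unit vector inside the hyperplane: it has norm 1 and is
  orthogonal to everything with real part 0.\<close>

lemma qone_in_plus_part:
  assumes "admissible_ring n R"
  shows "qone \<in> plus_part n R"
proof -
  have "1 = Complex 1 (0 * sqrt (real d))" for d
    by (simp add: complex_eq_iff)
  then have "1 \<in> imag_quadratic_field d" for d
    unfolding imag_quadratic_field_def using Rats_0 Rats_1 by blast
  then have "qone \<in> imag_quadratic_integers d" for d
    unfolding imag_quadratic_integers_def qone_def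
    by (auto intro!: algebraic_int.intros[of "[:-1, 1:]"] simp: coeff_pCons split: nat.splits)
  then have "qone \<in> R"
    using assms
    unfolding admissible_ring_def is_maximal_order_def is_maximal_dagger_order_def is_dagger_order_def
      is_order_def
    by blast
  then show ?thesis
    by (auto simp: plus_part_def dagger_def qone_def)
qed

section \<open>The Lorentz model\<close>

text \<open>
  Light-cone coordinates: \<open>lightcone x p q\<close> has \<open>lorentz_form\<close> equal to \<open>x \<bullet> x - p * q\<close>, and the sphere
  with center \<open>c\<close> and radius \<open>r\<close> corresponds to the spacelike unit vector
  \<open>lightcone (c / r) ((c \<bullet> c - r\<^sup>2) / r) (1 / r)\<close>.
\<close>

definition lightcone :: "'a::euclidean_space \<Rightarrow> real \<Rightarrow> real \<Rightarrow> 'a lorentz" where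
  "lightcone x p q = (x, (p - q) / 2, (p + q) / 2)"

definition lightcone_p :: "'a::euclidean_space lorentz \<Rightarrow> real" where
  "lightcone_p v = snd (snd v) + fst (snd v)"

definition lightcone_q :: "'a::euclidean_space lorentz \<Rightarrow> real" where
  "lightcone_q v = snd (snd v) - fst (snd v)"

lemma lightcone_eta: "lightcone (fst v) (lightcone_p v) (lightcone_q v) = v"
  by (simp add: lightcone_def lightcone_p_def lightcone_q_def prod_eq_iff)

lemma lightcone_cases: obtains x p q where "v = lightcone x p q"
  by (metis lightcone_eta)

lemma lightcone_sel [simp]:
  "fst (lightcone x p q) = x"
  "lightcone_p (lightcone x p q) = p"
  "lightcone_q (lightcone x p q) = q"
  by (simp_all add: lightcone_def lightcone_p_def lightcone_q_def field_simps)

lemma lightcone_eq_iff: "lightcone x p q = lightcone x' p' q' \<longleftrightarrow> x = x' \<and> p = p' \<and> q = q'"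
  by (metis lightcone_sel)

lemma lightcone_arith:
  "lightcone x p q + lightcone x' p' q' = lightcone (x + x') (p + p') (q + q')"
  "lightcone x p q - lightcone x' p' q' = lightcone (x - x') (p - p') (q - q')"
  "- lightcone x p q = lightcone (- x) (- p) (- q)"
  "c *\<^sub>R lightcone x p q = lightcone (c *\<^sub>R x) (c * p) (c * q)"
  by (simp_all add: lightcone_def field_simps)

lemma lorentz_form_lightcone:
  "lorentz_form (lightcone x p q) (lightcone x' p' q') = x \<bullet> x' - (p * q' + q * p') / 2"
  by (simp add: lorentz_form_def lightcone_def field_simps)

lemma lorentz_form_commute: "lorentz_form v w = lorentz_form w v"
  by (simp add: lorentz_form_def inner_commute mult.commute)

lemma lorentz_form_arith [simp]:
  "lorentz_form (v + v') w = lorentz_form v w + lorentz_form v' w"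
  "lorentz_form w (v + v') = lorentz_form w v + lorentz_form w v'"
  "lorentz_form (v - v') w = lorentz_form v w - lorentz_form v' w"
  "lorentz_form w (v - v') = lorentz_form w v - lorentz_form w v'"
  "lorentz_form (- v) w = - lorentz_form v w"
  "lorentz_form w (- v) = - lorentz_form w v"
  "lorentz_form (c *\<^sub>R v) w = c * lorentz_form v w"
  "lorentz_form w (c *\<^sub>R v) = c * lorentz_form w v"
  "lorentz_form 0 w = 0" "lorentz_form w 0 = 0"
  by (simp_all add: lorentz_form_def algebra_simps inner_add_left inner_add_right inner_diff_left
      inner_diff_right)

lemma lorentz_form_nondegenerate:
  assumes "\<And>w. lorentz_form v w = 0"
  shows "v = 0"
proof -
  \<comment> \<open>Pairing \<open>v\<close> with its time reversal gives the Euclidean square of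
    its norm.\<close>
  have "fst v \<bullet> fst v + (fst (snd v))\<^sup>2 + (snd (snd v))\<^sup>2 = 0"
    using assms[of "(fst v, fst (snd v), - snd (snd v))"]
    by (simp add: lorentz_form_def power2_eq_square)
  then show ?thesis
    by (simp add: add_nonneg_eq_0_iff prod_eq_iff)
qed

section \<open>The hyperboloid as a model of the half-space\<close>

lemma to_hyperboloid_lightcone:
  assumes "z \<in> upper_half_space"
  shows "to_hyperboloid z = lightcone ((1 / snd z) *\<^sub>R fst z) ((norm z)\<^sup>2 / snd z) (1 / snd z)"
  using assms by (simp add: to_hyperboloid_def lightcone_def upper_half_space_def field_simps)

lemma norm_power2_prod: "(norm (z :: 'a::euclidean_space \<times> real))\<^sup>2 = fst z \<bullet> fst z + (snd z)\<^sup>2"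
  by (cases z) (simp add: norm_Pair power2_norm_eq_inner)

lemma lorentz_form_to_hyperboloid:
  assumes "z \<in> upper_half_space" "w \<in> upper_half_space"
  shows "- lorentz_form (to_hyperboloid z) (to_hyperboloid w) = 1 + (dist z w)\<^sup>2 / (2 * snd z * snd w)"
proof -
  have pos: "snd z > 0" "snd w > 0"
    using assms by (auto simp: upper_half_space_def)
  have d: "(dist z w)\<^sup>2 = (norm z)\<^sup>2 + (norm w)\<^sup>2 - 2 * (fst z \<bullet> fst w) - 2 * snd z * snd w"
    unfolding dist_norm norm_power2_prod
    by (simp add: inner_diff_left inner_diff_right inner_commute power2_eq_square algebra_simps)
  show ?thesis
    unfolding d using pos
    by (simp add: to_hyperboloid_lightcone assms lorentz_form_lightcone field_simps)
qed

lemma to_hyperboloid_sheet: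
  assumes "z \<in> upper_half_space"
  shows "lorentz_form (to_hyperboloid z) (to_hyperboloid z) = -1" "snd (snd (to_hyperboloid z)) > 0"
  using lorentz_form_to_hyperboloid[OF assms assms] assms
  by (auto simp: to_hyperboloid_def upper_half_space_def intro!: divide_pos_pos add_nonneg_pos)

text \<open>Here \<open>p * q = x \<bullet> x + 1\<close> is positive, so \<open>p\<close>,
  \<open>q\<close> and \<open>p + q\<close> share one sign. The criterion suits translations, which
  leave \<open>q\<close> unchanged.\<close>

lemma sheet_iff_lightcone_q_pos:
  assumes "lorentz_form v v = -1"
  shows "snd (snd v) > 0 \<longleftrightarrow> lightcone_q v > 0"
proof -
  obtain x p q where v: "v = lightcone x p q"
    by (rule lightcone_cases)
  have "p * q = x \<bullet> x + 1"
    using assms by (simp add: v lorentz_form_lightcone mult.commute)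
  then have "p * q > 0"
    by (simp add: add_nonneg_pos)
  then show ?thesis
    by (auto simp: v zero_less_mult_iff) (auto simp: lightcone_def)
qed

lemma sheet_eq_to_hyperboloid:
  assumes "lorentz_form v v = -1" "snd (snd v) > 0"
  obtains z where "z \<in> upper_half_space" "v = to_hyperboloid z"
proof -
  obtain x p q where v: "v = lightcone x p q"
    by (rule lightcone_cases)
  have q: "q > 0"
    using sheet_iff_lightcone_q_pos[OF assms(1)] assms(2) by (simp add: v)
  have pq: "p * q = x \<bullet> x + 1"
    using assms by (simp add: v lorentz_form_lightcone mult.commute)
  \<comment> \<open>A point of height t has \<open>q = 1 / t\<close> and vector part divided by t;
    this solves for the point.\<close>
  define z where "z = ((1 / q) *\<^sub>R x, 1 / q)"
  have z: "z \<in> upper_half_space"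
    using q by (simp add: z_def upper_half_space_def)
  have "(norm z)\<^sup>2 / snd z = (x \<bullet> x + 1) / q"
    unfolding norm_power2_prod using q by (simp add: z_def field_simps power2_eq_square)
  also have "\<dots> = p"
    using pq q by (simp add: field_simps)
  finally have "to_hyperboloid z = v"
    unfolding to_hyperboloid_lightcone[OF z] v using q by (simp add: z_def)
  with z that show thesis
    by metis
qed

lemma to_hyperboloid_inj:
  assumes "z \<in> upper_half_space" "w \<in> upper_half_space" "to_hyperboloid z = to_hyperboloid w"
  shows "z = w"
proof -
  have "1 / snd z = 1 / snd w" "(1 / snd z) *\<^sub>R fst z = (1 / snd w) *\<^sub>R fst w"
    using assms(3) unfolding to_hyperboloid_lightcone[OF assms(1)] to_hyperboloid_lightcone[OF assms(2)]
      lightcone_eq_iff by blast+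
  then show ?thesis
    using assms(1) by (auto simp: upper_half_space_def prod_eq_iff)
qed

lemma hdist_eq_lorentz_form:
  assumes "z \<in> upper_half_space" "w \<in> upper_half_space"
  shows "hdist z w = arcosh (- lorentz_form (to_hyperboloid z) (to_hyperboloid w))"
  using lorentz_form_to_hyperboloid[OF assms] by (simp add: hdist_def)

lemma lorentz_form_to_hyperboloid_le:
  assumes "z \<in> upper_half_space" "w \<in> upper_half_space"
  shows "lorentz_form (to_hyperboloid z) (to_hyperboloid w) \<le> -1"
proof -
  have "0 \<le> (dist z w)\<^sup>2 / (2 * snd z * snd w)"
    using assms by (simp add: upper_half_space_def)
  then show ?thesis
    using lorentz_form_to_hyperboloid[OF assms] by linarith
qed

lemma hdist_eq_iff:
  assumes "z \<in> upper_half_space" "w \<in> upper_half_space" "z' \<in> upper_half_space" "w' \<in> upper_half_space"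
  shows "hdist z w = hdist z' w' \<longleftrightarrow>
    lorentz_form (to_hyperboloid z) (to_hyperboloid w) =
    lorentz_form (to_hyperboloid z') (to_hyperboloid w')"
proof -
  have "arcosh x = arcosh y \<longleftrightarrow> x = y" if "x \<ge> 1" "y \<ge> 1" for x y :: real
    using that by (metis cosh_arcosh_real)
  then show ?thesis
    using lorentz_form_to_hyperboloid_le[OF assms(1,2)] lorentz_form_to_hyperboloid_le[OF assms(3,4)]
    by (simp add: hdist_eq_lorentz_form assms)
qed

text \<open>After scaling by \<open>2 * t\<close> all points have \<open>q = 2\<close>, so two
  heights over the origin differ by a multiple of the null vector \<open>lightcone 0 1 0\<close>
  (heights 2 and 1 give 8 - 2 = 6). The other null vector and the spatial directions follow.\<close>

lemma span_to_hyperboloid: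
  "span (to_hyperboloid ` (upper_half_space :: ('a::euclidean_space \<times> real) set)) = UNIV"
proof -
  let ?U = "span (to_hyperboloid ` (upper_half_space :: ('a \<times> real) set))"
  have mem: "lightcone (2 *\<^sub>R x) (2 * (x \<bullet> x + t\<^sup>2)) 2 \<in> ?U" if "t > 0" for x :: 'a and t
  proof -
    have "(x, t) \<in> upper_half_space"
      using that by (simp add: upper_half_space_def)
    then have "(2 * t) *\<^sub>R to_hyperboloid (x, t) \<in> ?U"
      by (blast intro: span_mul span_base)
    moreover have "(2 * t) *\<^sub>R to_hyperboloid (x, t) = lightcone (2 *\<^sub>R x) (2 * (x \<bullet> x + t\<^sup>2)) 2"
      unfolding to_hyperboloid_lightcone[OF \<open>(x, t) \<in> _\<close>] norm_power2_prod using that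
      by (simp add: lightcone_arith)
    ultimately show ?thesis
      by simp
  qed
  have p: "lightcone 0 1 0 \<in> ?U"
    using span_mul[OF span_diff[OF mem[of 2 0] mem[of 1 0]], of "1 / 6"]
    by (simp add: lightcone_arith)
  have q: "lightcone 0 0 1 \<in> ?U"
    using span_mul[OF span_diff[OF mem[of 1 0] span_mul[OF p, of 2]], of "1 / 2"]
    by (simp add: lightcone_arith)
  have "lightcone x a b \<in> ?U" for x a b
  proof -
    define y where "y = (1 / 2) *\<^sub>R x"
    have "lightcone x a b = lightcone (2 *\<^sub>R y) (2 * (y \<bullet> y + 1\<^sup>2)) 2
        + (a - 2 * (y \<bullet> y + 1\<^sup>2)) *\<^sub>R lightcone 0 1 0 + (b - 2) *\<^sub>R lightcone 0 0 1"
      by (simp add: lightcone_arith y_def)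
    moreover have "\<dots> \<in> ?U"
      by (intro span_add span_mul p q mem) simp
    ultimately show ?thesis
      by simp
  qed
  then show ?thesis
    by (metis UNIV_eq_I lightcone_cases)
qed

lemma hyperboloid_basis:
  obtains B :: "'a::euclidean_space lorentz set" where "finite B" "independent B" "span B = UNIV"
    "B \<subseteq> to_hyperboloid ` upper_half_space"
proof -
  obtain B :: "'a lorentz set" where B: "B \<subseteq> to_hyperboloid ` upper_half_space" "independent B"
    "to_hyperboloid ` upper_half_space \<subseteq> span B"
    using maximal_independent_subset by blast
  then have "span B = UNIV"
    by (metis span_to_hyperboloid span_mono span_span top.extremum_uniqueI)
  with B that show thesis
    using independent_imp_finite by blast
qed

lemma lorentz_form_eq_on_spanning:
  fixes g :: "'a::euclidean_space lorentz \<Rightarrow> 'a lorentz"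
  assumes "linear g" "span B = UNIV"
    and "\<And>v w. v \<in> B \<Longrightarrow> w \<in> B \<Longrightarrow> lorentz_form (g v) (g w) = lorentz_form v w"
  shows "lorentz_form (g v) (g w) = lorentz_form v w"
proof -
  have lin: "linear (\<lambda>v. lorentz_form (g v) (g w) - lorentz_form v w)" for w
    using assms(1) by (intro linearI) (simp_all add: linear_add linear_scale algebra_simps)
  have *: "lorentz_form (g v) (g w) - lorentz_form v w = 0" if "w \<in> B" for v w
    by (rule linear_eq_0_on_span[OF lin, where b = B]) (use assms(2,3) that in auto)
  have "lorentz_form (g v) (g w) - lorentz_form v w = 0"
  proof (rule linear_eq_0_on_span[OF lin, where b = B])
    fix x assume "x \<in> B"
    then show "lorentz_form (g x) (g w) - lorentz_form x w = 0"
      using *[of x w] by (metis lorentz_form_commute)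
  qed (simp add: assms(2))
  then show ?thesis
    by simp
qed

section \<open>The isomorphism of the isometry group with the Lorentz group\<close>

lemma O_plus_form: "g \<in> O_plus \<Longrightarrow> lorentz_form (blinfun_apply g v) (blinfun_apply g w) = lorentz_form v w"
  unfolding O_plus_def by blast

lemma blinfun_eq_on_hyperboloid:
  fixes g g' :: "'a::euclidean_space lorentz \<Rightarrow>\<^sub>L 'a lorentz"
  assumes "\<And>z. z \<in> upper_half_space \<Longrightarrow>
      blinfun_apply g (to_hyperboloid z) = blinfun_apply g' (to_hyperboloid z)"
  shows "g = g'"
proof (rule blinfun_eqI)
  fix v
  show "blinfun_apply g v = blinfun_apply g' v"
    by (rule linear_eq_on_span[where B = "to_hyperboloid ` upper_half_space"])
      (use assms span_to_hyperboloid in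
        \<open>auto simp: bounded_linear.linear blinfun.bounded_linear_right\<close>)
qed

lemma lorentz_rep_eqI:
  assumes "g \<in> O_plus"
    and "\<And>z. z \<in> upper_half_space \<Longrightarrow> to_hyperboloid (f z) = blinfun_apply g (to_hyperboloid z)"
  shows "lorentz_rep f = g"
  unfolding lorentz_rep_def
proof (rule the_equality)
  fix g' assume "g' \<in> O_plus \<and>
    (\<forall>z\<in>upper_half_space. to_hyperboloid (f z) = blinfun_apply g' (to_hyperboloid z))"
  then show "g' = g"
    using assms by (intro blinfun_eq_on_hyperboloid) metis
qed (use assms in blast)

lemma Isom_mem: "f \<in> Isom \<Longrightarrow> z \<in> upper_half_space \<Longrightarrow> f z \<in> upper_half_space"
  by (auto simp: Isom_def Bij_def bij_betw_def)

text \<open>The induced map \<open>F\<close> of the hyperboloid preserves the form. A linear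
  \<open>g\<close> is made to agree with \<open>F\<close> on a basis of hyperboloid points;
  nondegeneracy then forces agreement on the whole hyperboloid.\<close>

lemma Isom_imp_O_plus:
  fixes f :: "'a::euclidean_space \<times> real \<Rightarrow> 'a \<times> real"
  assumes "f \<in> Isom"
  obtains g where "g \<in> O_plus"
    "\<And>z. z \<in> upper_half_space \<Longrightarrow> to_hyperboloid (f z) = blinfun_apply g (to_hyperboloid z)"
proof -
  let ?U = "upper_half_space :: ('a \<times> real) set"
  define F where "F v = to_hyperboloid (f (inv_into ?U to_hyperboloid v))" for v
  have F: "F (to_hyperboloid z) = to_hyperboloid (f z)" if "z \<in> ?U" for z
    unfolding F_def using that
    by (subst inv_into_f_f) (auto intro: inj_onI to_hyperboloid_inj)
  have Fform: "lorentz_form (F v) (F w) = lorentz_form v w"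
    if "v \<in> to_hyperboloid ` ?U" "w \<in> to_hyperboloid ` ?U" for v w
  proof -
    obtain y z where "y \<in> ?U" "z \<in> ?U" "v = to_hyperboloid y" "w = to_hyperboloid z"
      using \<open>v \<in> _\<close> \<open>w \<in> _\<close> by blast
    moreover have "hdist (f y) (f z) = hdist y z"
      using assms \<open>y \<in> ?U\<close> \<open>z \<in> ?U\<close> by (simp add: Isom_def)
    ultimately show ?thesis
      using hdist_eq_iff[of "f y" "f z" y z] by (simp add: F Isom_mem[OF assms])
  qed
  obtain B :: "'a lorentz set" where B: "finite B" "independent B" "span B = UNIV"
    "B \<subseteq> to_hyperboloid ` ?U"
    using hyperboloid_basis by blast
  obtain g where g: "linear g" "\<And>b. b \<in> B \<Longrightarrow> g b = F b"
    using linear_independent_extend[OF B(2), of F] by blast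
  have form: "lorentz_form (g v) (g w) = lorentz_form v w" for v w
    by (rule lorentz_form_eq_on_spanning[OF g(1) B(3)]) (metis Fform g(2) B(4) subsetD)
  have "inj g"
    unfolding linear_injective_0[OF g(1)]
    using form lorentz_form_nondegenerate by (metis lorentz_form_arith(9))
  then have surj: "surj g"
    using linear_injective_imp_surjective[OF g(1)] by simp
  have gF: "g v = F v" if v: "v \<in> to_hyperboloid ` ?U" for v
  proof -
    \<comment> \<open>The error \<open>F v - g v\<close> is orthogonal to every \<open>g b\<close>
      with \<open>b \<in> B\<close>, hence to the range of \<open>g\<close>, which is
      everything.\<close>
    have "lorentz_form (g w) (F v - g v) = 0" for w
    proof (rule linear_eq_0_on_span[where b = B and f = "\<lambda>w. lorentz_form (g w) (F v - g v)"])
      show "linear (\<lambda>w. lorentz_form (g w) (F v - g v))"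
        by (rule linearI) (simp_all add: linear_add[OF g(1)] linear_scale[OF g(1)] algebra_simps)
      fix b assume "b \<in> B"
      then have "lorentz_form (F b) (F v) = lorentz_form (g b) (g v)"
        using Fform[OF _ v] form B(4) by (metis subsetD)
      then show "lorentz_form (g b) (F v - g v) = 0"
        using g(2) \<open>b \<in> B\<close> by simp
    qed (simp add: B(3))
    then have "lorentz_form (F v - g v) w = 0" for w
      using surj lorentz_form_commute by (metis surjD)
    then show ?thesis
      using lorentz_form_nondegenerate by fastforce
  qed
  have g_apply: "blinfun_apply (Blinfun g) = g"
    using g(1) by (simp add: bounded_linear_Blinfun_apply linear_conv_bounded_linear)
  have sheet: "snd (snd (g v)) > 0" if "lorentz_form v v = -1" "snd (snd v) > 0" for v
    using that sheet_eq_to_hyperboloid[OF that]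
    by (metis F Isom_mem[OF assms] gF image_eqI to_hyperboloid_sheet(2))
  have "Blinfun g \<in> O_plus"
    using form sheet by (simp add: O_plus_def g_apply del: split_paired_All)
  then show thesis
    using that g_apply gF F by (metis image_eqI)
qed

lemma lorentz_rep_Isom:
  assumes "f \<in> Isom"
  shows "lorentz_rep f \<in> O_plus"
    and "z \<in> upper_half_space \<Longrightarrow>
      to_hyperboloid (f z) = blinfun_apply (lorentz_rep f) (to_hyperboloid z)"
  using Isom_imp_O_plus[OF assms] lorentz_rep_eqI by metis+

text \<open>Preservation of \<open>hdist\<close> is inherited from the Lorentz transformation that
  induces \<open>f\<close>, so concrete maps only need an explicit inverse.\<close>

lemma IsomI:
  assumes "f \<in> extensional upper_half_space"
    and maps: "\<And>z. z \<in> upper_half_space \<Longrightarrow> f z \<in> upper_half_space"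
      "\<And>z. z \<in> upper_half_space \<Longrightarrow> f' z \<in> upper_half_space"
    and inverse: "\<And>z. z \<in> upper_half_space \<Longrightarrow> f (f' z) = z"
      "\<And>z. z \<in> upper_half_space \<Longrightarrow> f' (f z) = z"
    and "g \<in> O_plus"
    and "\<And>z. z \<in> upper_half_space \<Longrightarrow> to_hyperboloid (f z) = blinfun_apply g (to_hyperboloid z)"
  shows "f \<in> Isom"
proof -
  have "bij_betw f upper_half_space upper_half_space"
    by (rule bij_betw_byWitness[where f' = f']) (use maps inverse in auto)
  then show ?thesis
    using assms(1) maps(1) by (simp add: Isom_def Bij_def hdist_eq_iff assms(7) O_plus_form[OF assms(6)])
qed

section \<open>Group structure and multiplicativity of \<open>lorentz_rep\<close>\<close>

lemma O_plus_compose: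
  assumes "g \<in> O_plus" "h \<in> O_plus"
  shows "g o\<^sub>L h \<in> O_plus"
  using assms by (simp add: O_plus_def del: split_paired_All)

lemma subgroup_Isom: "subgroup Isom (BijGroup (upper_half_space :: ('a::euclidean_space \<times> real) set))"
proof
  let ?U = "upper_half_space :: ('a \<times> real) set"
  show "Isom \<subseteq> carrier (BijGroup ?U)"
    by (auto simp: Isom_def BijGroup_def)
  show "\<one>\<^bsub>BijGroup ?U\<^esub> \<in> Isom"
    by (auto simp: Isom_def BijGroup_def id_Bij)
  fix f :: "'a \<times> real \<Rightarrow> 'a \<times> real" assume f: "f \<in> Isom"
  then have fB: "f \<in> Bij ?U"
    by (simp add: Isom_def)
  show "inv\<^bsub>BijGroup ?U\<^esub> f \<in> Isom"
  proof -
    have "hdist (inv_into ?U f z) (inv_into ?U f w) = hdist z w" if "z \<in> ?U" "w \<in> ?U" for z w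
    proof -
      have "f (inv_into ?U f z) = z" "f (inv_into ?U f w) = w"
        using fB that by (auto simp: Bij_def bij_betw_def intro!: f_inv_into_f)
      then show ?thesis
        using f Bij_inv_into_mem[OF fB] that unfolding Isom_def by (metis (mono_tags, lifting) mem_Collect_eq)
    qed
    then show ?thesis
      by (simp add: inv_BijGroup fB Isom_def restrict_inv_into_Bij)
  qed
  fix h :: "'a \<times> real \<Rightarrow> 'a \<times> real" assume h: "h \<in> Isom"
  then have "h \<in> Bij ?U"
    by (simp add: Isom_def)
  then show "f \<otimes>\<^bsub>BijGroup ?U\<^esub> h \<in> Isom"
    using f h fB Isom_mem[OF h] by (simp add: BijGroup_def Isom_def compose_Bij compose_eq)
qed

lemma group_Isom_group: "group (Isom_group :: ('a::euclidean_space \<times> real \<Rightarrow> 'a \<times> real) monoid)"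
  unfolding Isom_group_def
  by (rule subgroup.subgroup_is_group[OF subgroup_Isom group_BijGroup])

lemma carrier_Isom_group [simp]: "carrier Isom_group = Isom"
  by (simp add: Isom_group_def)

lemma mult_Isom_group:
  "f \<in> Isom \<Longrightarrow> h \<in> Isom \<Longrightarrow> f \<otimes>\<^bsub>Isom_group\<^esub> h = compose upper_half_space f h"
  by (simp add: Isom_group_def BijGroup_def Isom_def)

lemma one_Isom_group: "\<one>\<^bsub>Isom_group\<^esub> = (\<lambda>z\<in>upper_half_space. z)"
  by (simp add: Isom_group_def BijGroup_def)

lemma lorentz_rep_one: "lorentz_rep \<one>\<^bsub>Isom_group\<^esub> = id_blinfun"
  by (rule lorentz_rep_eqI) (auto simp: O_plus_def one_Isom_group)

lemma lorentz_rep_mult: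
  assumes "f \<in> Isom" "h \<in> Isom"
  shows "lorentz_rep (f \<otimes>\<^bsub>Isom_group\<^esub> h) = lorentz_rep f o\<^sub>L lorentz_rep h"
  using assms
  by (intro lorentz_rep_eqI)
    (auto simp: O_plus_compose lorentz_rep_Isom mult_Isom_group compose_eq Isom_mem)

section \<open>Reflections and translations in the Lorentz group\<close>

text \<open>For \<open>lorentz_form v v = 1\<close> this is the orthogonal reflection in the
  complement of \<open>v\<close>; for other \<open>v\<close> the formula is just a linear
  map.\<close>

definition reflection :: "'a::euclidean_space lorentz \<Rightarrow> ('a lorentz \<Rightarrow>\<^sub>L 'a lorentz)" where
  "reflection v = Blinfun (\<lambda>w. w - (2 * lorentz_form w v) *\<^sub>R v)"

lemma reflection_apply: "blinfun_apply (reflection v) w = w - (2 * lorentz_form w v) *\<^sub>R v"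
proof -
  have "linear (\<lambda>w. w - (2 * lorentz_form w v) *\<^sub>R v)"
    by (rule linearI) (simp_all add: algebra_simps)
  then show ?thesis
    by (simp add: reflection_def bounded_linear_Blinfun_apply linear_conv_bounded_linear)
qed

lemma reflection_uminus: "reflection (- v) = reflection v"
  by (rule blinfun_eqI) (simp add: reflection_apply)

lemma lorentz_form_reflection:
  assumes "lorentz_form v v = 1"
  shows "lorentz_form (reflection v x) (reflection v y) = lorentz_form x y"
  using assms lorentz_form_commute[of v y] by (simp add: reflection_apply algebra_simps)

lemma reflection_reflection:
  assumes "lorentz_form v v = 1"
  shows "reflection v (reflection v x) = x"
  using assms by (simp add: reflection_apply algebra_simps)

lemma reflection_conjugate:
  assumes "\<And>x y. lorentz_form (blinfun_apply g x) (blinfun_apply g y) = lorentz_form x y"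
    and "\<And>x. blinfun_apply g (blinfun_apply g' x) = x"
  shows "reflection (blinfun_apply g v) = g o\<^sub>L reflection v o\<^sub>L g'"
proof (rule blinfun_eqI)
  fix w
  have "lorentz_form w (g v) = lorentz_form (g' w) v"
    using assms(1)[of "g' w" v] assms(2)[of w] by simp
  then show "blinfun_apply (reflection (g v)) w = blinfun_apply (g o\<^sub>L reflection v o\<^sub>L g') w"
    by (simp add: reflection_apply blinfun.diff_right blinfun.scaleR_right assms(2))
qed

text \<open>If the image y of x fell on the lower sheet, x and -y would be points of the upper
  sheet, so the product of x and y would be at least 1. But it equals
  \<open>-1 - 2 * (lorentz_form x v)\<^sup>2\<close>.\<close>

lemma reflection_in_O_plus:
  assumes "lorentz_form v v = 1"
  shows "reflection v \<in> O_plus"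
proof -
  have "snd (snd (reflection v x)) > 0" if x: "lorentz_form x x = -1" "snd (snd x) > 0" for x
  proof (rule ccontr)
    let ?y = "blinfun_apply (reflection v) x"
    assume neg: "\<not> snd (snd ?y) > 0"
    have y: "lorentz_form ?y ?y = -1"
      using lorentz_form_reflection[OF assms] x by simp
    have "snd (snd ?y) \<noteq> 0"
    proof
      assume "snd (snd ?y) = 0"
      then have "lorentz_form ?y ?y = fst ?y \<bullet> fst ?y + (fst (snd ?y))\<^sup>2"
        by (simp add: lorentz_form_def power2_eq_square)
      then show False
        using y by (smt (verit) inner_ge_zero zero_le_power2)
    qed
    then have "snd (snd (- ?y)) > 0" "lorentz_form (- ?y) (- ?y) = -1"
      using neg y by simp_all
    then have "lorentz_form x (- ?y) \<le> -1"
      using x lorentz_form_to_hyperboloid_le by (metis sheet_eq_to_hyperboloid)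
    moreover have "lorentz_form x ?y = -1 - 2 * (lorentz_form x v)\<^sup>2"
      using x(1) by (simp add: reflection_apply power2_eq_square)
    ultimately show False
      by (simp, smt (verit) zero_le_power2)
  qed
  then show ?thesis
    using lorentz_form_reflection[OF assms] by (simp add: O_plus_def del: split_paired_All)
qed

text \<open>
  A translation acts unipotently; \<open>translation_gen h\<close> is its logarithm, which satisfies \<open>N\<^sup>3 = 0\<close>.
\<close>

definition translation_gen :: "'a::euclidean_space \<Rightarrow> ('a lorentz \<Rightarrow>\<^sub>L 'a lorentz)" where
  "translation_gen h = Blinfun (\<lambda>w. lightcone (lightcone_q w *\<^sub>R h) (2 * (fst w \<bullet> h)) 0)"

definition lorentz_translation :: "'a::euclidean_space \<Rightarrow> ('a lorentz \<Rightarrow>\<^sub>L 'a lorentz)" where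
  "lorentz_translation h =
    id_blinfun + translation_gen h + (1 / 2) *\<^sub>R (translation_gen h o\<^sub>L translation_gen h)"

lemma translation_gen_apply:
  "blinfun_apply (translation_gen h) (lightcone x p q) = lightcone (q *\<^sub>R h) (2 * (x \<bullet> h)) 0"
proof -
  have "linear (\<lambda>w. lightcone (lightcone_q w *\<^sub>R h) (2 * (fst w \<bullet> h)) 0)"
    by (rule linearI)
      (simp_all add: lightcone_arith lightcone_eq_iff lightcone_q_def algebra_simps inner_add_left)
  then show ?thesis
    by (simp add: translation_gen_def bounded_linear_Blinfun_apply linear_conv_bounded_linear)
qed

lemma lorentz_translation_apply:
  "blinfun_apply (lorentz_translation h) (lightcone x p q) =
    lightcone (x + q *\<^sub>R h) (p + 2 * (x \<bullet> h) + q * (h \<bullet> h)) q"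
  by (simp add: lorentz_translation_def translation_gen_apply plus_blinfun.rep_eq
      scaleR_blinfun.rep_eq lightcone_arith)

text \<open>The exponential series of t N stops at the quadratic term, so a one-parameter group of
  translations is a polynomial curve of endomorphisms.\<close>

lemma lorentz_translation_scaleR:
  fixes h :: "'a::euclidean_space"
  shows "lorentz_translation (t *\<^sub>R h) =
    id_blinfun + t *\<^sub>R translation_gen h + (t\<^sup>2 / 2) *\<^sub>R (translation_gen h o\<^sub>L translation_gen h)"
proof (rule blinfun_eqI)
  fix w :: "'a lorentz"
  obtain x p q where w: "w = lightcone x p q"
    by (rule lightcone_cases)
  show "blinfun_apply (lorentz_translation (t *\<^sub>R h)) w = blinfun_apply
    (id_blinfun + t *\<^sub>R translation_gen h + (t\<^sup>2 / 2) *\<^sub>R (translation_gen h o\<^sub>L translation_gen h)) w"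
    by (simp add: w lorentz_translation_apply translation_gen_apply plus_blinfun.rep_eq scaleR_blinfun.rep_eq
        lightcone_arith lightcone_eq_iff power2_eq_square)
qed

lemma lorentz_form_lorentz_translation:
  "lorentz_form (blinfun_apply (lorentz_translation h) v) (blinfun_apply (lorentz_translation h) w) =
    lorentz_form v w"
proof -
  obtain x p q x' p' q' where "v = lightcone x p q" "w = lightcone x' p' q'"
    by (metis lightcone_cases)
  then show ?thesis
    by (simp add: lorentz_translation_apply lorentz_form_lightcone inner_add_left inner_add_right inner_commute
        field_simps)
qed

lemma lorentz_translation_add:
  fixes h k :: "'a::euclidean_space"
  shows "lorentz_translation (h + k) = lorentz_translation h o\<^sub>L lorentz_translation k"
proof (rule blinfun_eqI)
  fix w :: "'a lorentz"
  obtain x p q where w: "w = lightcone x p q"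
    by (rule lightcone_cases)
  show "blinfun_apply (lorentz_translation (h + k)) w =
      blinfun_apply (lorentz_translation h o\<^sub>L lorentz_translation k) w"
    by (simp add: w lorentz_translation_apply lightcone_eq_iff inner_add_left inner_add_right inner_commute
        algebra_simps)
qed

lemma lorentz_translation_uminus_cancel:
  "blinfun_apply (lorentz_translation h) (blinfun_apply (lorentz_translation (- h)) w) = w"
  using lorentz_translation_scaleR[of 0 h] lorentz_translation_add[of h "- h"]
  by (simp flip: blinfun_apply_blinfun_compose)

lemma lorentz_translation_in_O_plus: "lorentz_translation h \<in> O_plus"
proof -
  have "snd (snd (blinfun_apply (lorentz_translation h) v)) > 0"
    if "lorentz_form v v = -1" "snd (snd v) > 0" for v
  proof -
    have "lightcone_q (blinfun_apply (lorentz_translation h) v) = lightcone_q v"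
      by (metis lightcone_eta lightcone_sel(3) lorentz_translation_apply)
    then show ?thesis
      using that sheet_iff_lightcone_q_pos lorentz_form_lorentz_translation by metis
  qed
  then show ?thesis
    by (simp add: O_plus_def lorentz_form_lorentz_translation del: split_paired_All)
qed

definition unit_sphere_vector :: "'a::euclidean_space \<Rightarrow> 'a lorentz" where
  "unit_sphere_vector c = lightcone c (c \<bullet> c - 1) 1"

lemma lorentz_form_unit_sphere_vector: "lorentz_form (unit_sphere_vector c) (unit_sphere_vector c) = 1"
  by (simp add: unit_sphere_vector_def lorentz_form_lightcone field_simps)

lemma lorentz_translation_unit_sphere_vector:
  "blinfun_apply (lorentz_translation h) (unit_sphere_vector c) = unit_sphere_vector (c + h)"
  by (simp add: unit_sphere_vector_def lorentz_translation_apply lightcone_eq_iff inner_add_left inner_add_right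
      inner_commute)

lemma reflection_lorentz_translation:
  "reflection (blinfun_apply (lorentz_translation h) v) =
    lorentz_translation h o\<^sub>L reflection v o\<^sub>L lorentz_translation (- h)"
  by (rule reflection_conjugate)
    (simp_all add: lorentz_form_lorentz_translation lorentz_translation_uminus_cancel)

section \<open>Generation by reflections\<close>

text \<open>The square of the difference is -2 - 2 times the product of \<open>v\<close> and
  \<open>w\<close>, and that product is below -1 for distinct points. So the difference can be
  normalized to the vector of a reflection.\<close>

lemma lorentz_form_diff_pos:
  assumes "lorentz_form v v = -1" "snd (snd v) > 0" "lorentz_form w w = -1" "snd (snd w) > 0" "v \<noteq> w"
  shows "lorentz_form (v - w) (v - w) > 0"
proof -
  obtain y where y: "y \<in> upper_half_space" "v = to_hyperboloid y"
    using assms sheet_eq_to_hyperboloid by metis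
  obtain z where z: "z \<in> upper_half_space" "w = to_hyperboloid z"
    using assms sheet_eq_to_hyperboloid by metis
  have "(dist y z)\<^sup>2 / (2 * snd y * snd z) > 0"
    using assms(5) y z by (auto simp: upper_half_space_def intro!: divide_pos_pos)
  then show ?thesis
    using lorentz_form_to_hyperboloid[OF y(1) z(1)] assms(1,3) lorentz_form_commute[of v w]
    by (simp add: y(2)[symmetric] z(2)[symmetric])
qed

text \<open>
  If an isometry moves a point \<open>b\<close> of the hyperboloid, then the reflection that exchanges \<open>b\<close> with
  its image fixes all points that the isometry fixes.
\<close>

lemma O_plus_subset_if_reflections:
  fixes G :: "('a::euclidean_space lorentz \<Rightarrow>\<^sub>L 'a lorentz) set"
  assumes "id_blinfun \<in> G" and comp: "\<And>g h. g \<in> G \<Longrightarrow> h \<in> G \<Longrightarrow> g o\<^sub>L h \<in> G"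
    and refl: "\<And>v. lorentz_form v v = 1 \<Longrightarrow> reflection v \<in> G"
  shows "O_plus \<subseteq> G"
proof
  fix g :: "'a lorentz \<Rightarrow>\<^sub>L 'a lorentz" assume "g \<in> O_plus"
  obtain B :: "'a lorentz set" where B: "finite B" "span B = UNIV" "B \<subseteq> to_hyperboloid ` upper_half_space"
    using hyperboloid_basis by metis
  have sheet: "lorentz_form b b = -1" "snd (snd b) > 0" if "b \<in> B" for b
    using B(3) that to_hyperboloid_sheet by (metis imageE subsetD)+
  show "g \<in> G"
    using \<open>g \<in> O_plus\<close>
  proof (induction "card {b \<in> B. blinfun_apply g b \<noteq> b}" arbitrary: g rule: less_induct)
    case less
    show ?case
    proof (cases "\<forall>b\<in>B. blinfun_apply g b = b")
      case True
      have "g = id_blinfun"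
      proof (rule blinfun_eqI)
        fix v
        show "blinfun_apply g v = blinfun_apply id_blinfun v"
          by (rule linear_eq_on_span[where B = B])
            (use True B(2) in \<open>auto simp: bounded_linear.linear blinfun.bounded_linear_right\<close>)
      qed
      then show ?thesis
        using assms(1) by simp
    next
      case False
      then obtain b where b: "b \<in> B" "blinfun_apply g b \<noteq> b"
        by blast
      define d where "d = blinfun_apply g b - b"
      have gb: "lorentz_form (g b) (g b) = -1" "snd (snd (g b)) > 0"
        using less.prems sheet[OF b(1)] by (auto simp: O_plus_def simp del: split_paired_All)
      have pos: "lorentz_form d d > 0"
        unfolding d_def using lorentz_form_diff_pos[OF gb sheet[OF b(1)] b(2)] .
      define v where "v = (1 / sqrt (lorentz_form d d)) *\<^sub>R d"
      have v: "lorentz_form v v = 1"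
        using pos by (simp add: v_def field_simps)
      have refl_v: "blinfun_apply (reflection v) w = w - (2 * lorentz_form w d / lorentz_form d d) *\<^sub>R d" for w
        using pos by (simp add: reflection_apply v_def field_simps)
      let ?g = "reflection v o\<^sub>L g"
      \<comment> \<open>Both points have square -1. Hence the coefficient in \<open>refl_v\<close>
        is 1 and the reflection subtracts exactly \<open>d\<close> from the image of
        \<open>b\<close>.\<close>
      have "2 * lorentz_form (g b) d = lorentz_form d d"
        using gb(1) sheet(1)[OF b(1)] lorentz_form_commute[of b "g b"] by (simp add: d_def)
      then have "blinfun_apply ?g b = b"
        using pos by (simp add: refl_v) (simp add: d_def)
      moreover have "blinfun_apply ?g c = c" if "blinfun_apply g c = c" for c
      proof -
        have "lorentz_form c d = 0"
          using O_plus_form[OF less.prems, of c b] that by (simp add: d_def)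
        then show ?thesis
          by (simp add: that refl_v)
      qed
      ultimately have "{b \<in> B. blinfun_apply ?g b \<noteq> b} \<subset> {b \<in> B. blinfun_apply g b \<noteq> b}"
        using b by blast
      then have "card {b \<in> B. blinfun_apply ?g b \<noteq> b} < card {b \<in> B. blinfun_apply g b \<noteq> b}"
        using B(1) by (simp add: psubset_card_mono)
      then have "?g \<in> G"
        using less.hyps less.prems O_plus_compose reflection_in_O_plus[OF v] by blast
      moreover have "g = reflection v o\<^sub>L ?g"
        by (rule blinfun_eqI) (simp add: reflection_reflection[OF v])
      ultimately show ?thesis
        using comp refl[OF v] by metis
    qed
  qed
qed

section \<open>Spheres over a hyperplane\<close>

text \<open>
  \<open>heights G e y q\<close> says that \<open>G\<close> contains the inversions in the spheres of radius \<open>1 / q\<close> whose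
  center has height \<open>y / q\<close> over the hyperplane orthogonal to \<open>e\<close>.
\<close>

definition heights ::
    "('a::euclidean_space lorentz \<Rightarrow>\<^sub>L 'a lorentz) set \<Rightarrow> 'a \<Rightarrow> real \<Rightarrow> real \<Rightarrow> bool" where
  "heights G e y q \<longleftrightarrow> (\<forall>h p. h \<bullet> e = 0 \<longrightarrow>
     lorentz_form (lightcone (y *\<^sub>R e + h) p q) (lightcone (y *\<^sub>R e + h) p q) = 1 \<longrightarrow>
     reflection (lightcone (y *\<^sub>R e + h) p q) \<in> G)"

text \<open>\<open>G\<close> will be the polynomial hull of the group, \<open>e\<close> the unit
  normal of the hyperplane, \<open>s\<close> the height of the second family of unit spheres, and
  \<open>f\<close> a unit vector inside the hyperplane.\<close>

locale hyperplane_reflections =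
  fixes G :: "('a::euclidean_space lorentz \<Rightarrow>\<^sub>L 'a lorentz) set" and e f :: 'a and s :: real
  assumes comp: "\<And>g h. g \<in> G \<Longrightarrow> h \<in> G \<Longrightarrow> g o\<^sub>L h \<in> G"
    and one: "id_blinfun \<in> G"
    and e: "e \<bullet> e = 1" and f: "f \<bullet> f = 1" "f \<bullet> e = 0" and s: "s \<noteq> 0"
    and translation: "\<And>h. h \<bullet> e = 0 \<Longrightarrow> lorentz_translation h \<in> G"
    and sphere_0: "\<And>h. h \<bullet> e = 0 \<Longrightarrow> reflection (unit_sphere_vector h) \<in> G"
    and sphere_s: "\<And>h. h \<bullet> e = 0 \<Longrightarrow> reflection (unit_sphere_vector (s *\<^sub>R e + h)) \<in> G"
begin

abbreviation N :: "'a lorentz set" where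
  "N \<equiv> {v. lorentz_form v v = 1 \<and> reflection v \<in> G}"

text \<open>As in a root system: the reflection in the image of \<open>w\<close> is a conjugate of
  the reflection in \<open>w\<close>.\<close>

lemma reflection_mem_N: "v \<in> N \<Longrightarrow> w \<in> N \<Longrightarrow> blinfun_apply (reflection v) w \<in> N"
  using reflection_conjugate[of "reflection v" "reflection v" w]
  by (simp add: comp lorentz_form_reflection reflection_reflection)

lemma uminus_mem_N: "- v \<in> N \<longleftrightarrow> v \<in> N"
  by (simp add: reflection_uminus)

lemma translation_mem_N:
  assumes "v \<in> N" "h \<bullet> e = 0"
  shows "blinfun_apply (lorentz_translation h) v \<in> N"
  using assms
  by (simp add: lorentz_form_lorentz_translation reflection_lorentz_translation comp translation)

lemma form_1_iff:
  assumes "h \<bullet> e = 0"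
  shows "lorentz_form (lightcone (y *\<^sub>R e + h) p q) (lightcone (y *\<^sub>R e + h) p q) = 1 \<longleftrightarrow>
    p * q = y\<^sup>2 + h \<bullet> h - 1"
proof -
  have "(y *\<^sub>R e + h) \<bullet> (y *\<^sub>R e + h) = y\<^sup>2 + h \<bullet> h"
    using assms e inner_commute[of e h]
    by (simp add: inner_add_left inner_add_right power2_eq_square)
  then show ?thesis
    by (auto simp: lorentz_form_lightcone mult.commute)
qed

lemma heights_D: "heights G e y q \<Longrightarrow> h \<bullet> e = 0 \<Longrightarrow> p * q = y\<^sup>2 + h \<bullet> h - 1 \<Longrightarrow>
    lightcone (y *\<^sub>R e + h) p q \<in> N"
  by (simp add: heights_def form_1_iff)

text \<open>Translations along the hyperplane move a sphere to every sphere of the same height and radius.\<close>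

lemma heights_I:
  assumes "lightcone (y *\<^sub>R e + h) p q \<in> N" "h \<bullet> e = 0" "q \<noteq> 0"
  shows "heights G e y q"
  unfolding heights_def
proof (intro allI impI)
  fix h' p'
  assume h': "h' \<bullet> e = 0"
    "lorentz_form (lightcone (y *\<^sub>R e + h') p' q) (lightcone (y *\<^sub>R e + h') p' q) = 1"
  have pq: "p * q = y\<^sup>2 + h \<bullet> h - 1" "p' * q = y\<^sup>2 + h' \<bullet> h' - 1"
    using assms h' by (simp_all add: form_1_iff)
  \<comment> \<open>Translating by \<open>k\<close> moves the vector part by \<open>q\<close> times
    \<open>k\<close>; the \<open>p\<close> coordinate is then forced by the norm being 1.\<close>
  define k where "k = (1 / q) *\<^sub>R (h' - h)"
  have k: "k \<bullet> e = 0" "q *\<^sub>R k = h' - h"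
    using assms h' by (simp_all add: k_def inner_diff_left)
  then have "h' = h + q *\<^sub>R k"
    by simp
  then have "h' \<bullet> h' = h \<bullet> h + 2 * q * (h \<bullet> k) + q * q * (k \<bullet> k)"
    by (simp add: inner_add_left inner_add_right inner_commute)
  then have "q * (p + 2 * (h \<bullet> k) + q * (k \<bullet> k)) = q * p'"
    using pq by (simp add: algebra_simps)
  then have "p + 2 * ((y *\<^sub>R e + h) \<bullet> k) + q * (k \<bullet> k) = p'"
    using assms(3) k(1) by (simp add: inner_add_left inner_commute[of e])
  then have "blinfun_apply (lorentz_translation k) (lightcone (y *\<^sub>R e + h) p q) =
      lightcone (y *\<^sub>R e + h') p' q"
    using k(2) by (simp add: lorentz_translation_apply)
  then show "reflection (lightcone (y *\<^sub>R e + h') p' q) \<in> G"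
    using translation_mem_N[OF assms(1) k(1)] by simp
qed

text \<open>The inversion in the unit sphere at the origin exchanges the two null coordinates. It
  changes the radius from \<open>1 / q\<close> to \<open>1 / p\<close> and keeps the coordinate
  \<open>y\<close>.\<close>

lemma swap_mem_N:
  assumes "lightcone x p q \<in> N"
  shows "lightcone x q p \<in> N"
proof -
  have "unit_sphere_vector 0 \<in> N"
    using sphere_0[of 0] lorentz_form_unit_sphere_vector[of 0] by simp
  moreover have "blinfun_apply (reflection (unit_sphere_vector 0)) (lightcone x p q) = lightcone x q p"
    by (simp add: reflection_apply unit_sphere_vector_def lorentz_form_lightcone lightcone_arith
        lightcone_eq_iff field_simps)
  ultimately show ?thesis
    using reflection_mem_N[of "unit_sphere_vector 0" "lightcone x p q"] assms by simp
qed

lemma exists_orthogonal_of_norm: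
  assumes "c \<ge> 0"
  obtains h where "h \<bullet> e = 0" "h \<bullet> h = c"
  using assms f that[of "sqrt c *\<^sub>R f"] by simp

lemma heights_scale:
  assumes "heights G e y q" "q > 0" "q' > 0"
  shows "heights G e y q'"
proof -
  \<comment> \<open>One swap passes from \<open>q\<close> to \<open>p'\<close> only if
    \<open>p' * q \<ge> y\<^sup>2 - 1\<close>, for otherwise no horizontal \<open>h\<close> has the
    required square. A detour over a large \<open>p\<close> meets this bound with both
    \<open>q\<close> and \<open>q'\<close>.\<close>
  define p where "p = (y\<^sup>2 + 1) / q + (y\<^sup>2 + 1) / q'"
  have p: "p > 0"
    using assms(2,3) by (auto simp: p_def add_nonneg_pos intro!: add_pos_pos divide_pos_pos)
  have swap: "heights G e y p'"
    if "heights G e y q" "p' > 0" and le: "p' * q \<ge> y\<^sup>2 - 1" for p' q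
  proof -
    obtain h where h: "h \<bullet> e = 0" "h \<bullet> h = p' * q - y\<^sup>2 + 1"
      using exists_orthogonal_of_norm[of "p' * q - y\<^sup>2 + 1"] le by auto
    have "lightcone (y *\<^sub>R e + h) p' q \<in> N"
      using heights_D[OF that(1) h(1)] h(2) by simp
    then show ?thesis
      using heights_I[OF swap_mem_N h(1)] that(2) by simp
  qed
  have "p * q \<ge> y\<^sup>2 - 1" "q' * p \<ge> y\<^sup>2 - 1"
  proof -
    have "0 \<le> (y\<^sup>2 + 1) * (q / q')" "0 \<le> (y\<^sup>2 + 1) * (q' / q)"
      using assms(2,3) by simp_all
    moreover have "p * q = (y\<^sup>2 + 1) + (y\<^sup>2 + 1) * (q / q')" "q' * p = (y\<^sup>2 + 1) * (q' / q) + (y\<^sup>2 + 1)"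
      using assms(2,3) by (simp_all add: p_def field_simps)
    ultimately show "p * q \<ge> y\<^sup>2 - 1" "q' * p \<ge> y\<^sup>2 - 1"
      by linarith+
  qed
  then show ?thesis
    using swap[OF swap[OF assms(1) p] assms(3)] by blast
qed

text \<open>
  Inverting a unit sphere of height \<open>y'\<close> in a unit sphere of height \<open>y\<close> whose center is at distance
  \<open>d\<close> gives height \<open>y' - (2 - d\<^sup>2) * y\<close> and \<open>q = d\<^sup>2 - 1\<close>; since the radius can be changed by
  lemma \<open>heights_scale\<close>, it is normalized to \<open>1\<close> again.
\<close>

lemma heights_invert:
  assumes "heights G e y 1" "heights G e y' 1" "c > 1" "c \<ge> (y - y')\<^sup>2"
  shows "heights G e (y' - (2 - c) * y) 1"
proof -
  \<comment> \<open>\<open>c\<close> is the squared distance of the centers and \<open>h\<close> its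
    horizontal share; \<open>c > 1\<close> keeps the new \<open>q\<close> positive.\<close>
  obtain h where h: "h \<bullet> e = 0" "h \<bullet> h = c - (y - y')\<^sup>2"
    using exists_orthogonal_of_norm[of "c - (y - y')\<^sup>2"] assms(4) by auto
  let ?v = "lightcone (y *\<^sub>R e + 0) (y\<^sup>2 - 1) 1"
  let ?w = "lightcone (y' *\<^sub>R e + h) (y'\<^sup>2 + h \<bullet> h - 1) 1"
  have vw: "?v \<in> N" "?w \<in> N"
    using heights_D[OF assms(1), of 0 "y\<^sup>2 - 1"] heights_D[OF assms(2) h(1), of "y'\<^sup>2 + h \<bullet> h - 1"]
    by simp_all
  have "2 * lorentz_form ?w ?v = 2 * y * y' - (y'\<^sup>2 + h \<bullet> h - 1 + (y\<^sup>2 - 1))"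
    by (simp add: lorentz_form_lightcone inner_add_left e h(1) field_simps)
  also have "\<dots> = 2 - c"
    unfolding h(2) by (simp add: power2_eq_square algebra_simps)
  finally have form: "2 * lorentz_form ?w ?v = 2 - c" .
  have "blinfun_apply (reflection ?v) ?w =
      lightcone ((y' - (2 - c) * y) *\<^sub>R e + h) (y'\<^sup>2 + h \<bullet> h - 1 - (2 - c) * (y\<^sup>2 - 1)) (c - 1)"
    unfolding reflection_apply form by (simp add: lightcone_arith lightcone_eq_iff algebra_simps)
  then have "heights G e (y' - (2 - c) * y) (c - 1)"
    using reflection_mem_N[OF vw] assms(3) by (intro heights_I[OF _ h(1)]) simp_all
  then show ?thesis
    using heights_scale[of _ "c - 1" 1] assms(3) by simp
qed

text \<open>Two unit spheres of equal height at squared distance \<open>1 + t\<close> give the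
  height \<open>y - (1 - t) * y\<close>.\<close>

lemma heights_dilate:
  assumes "heights G e y 1" "t > 0"
  shows "heights G e (t * y) 1"
  using heights_invert[OF assms(1,1), of "1 + t"] assms(2) by (simp add: algebra_simps)

lemma heights_all:
  assumes "q > 0"
  shows "heights G e y q"
proof -
  have unit: "heights G e c 1" if "reflection (unit_sphere_vector (c *\<^sub>R e)) \<in> G" for c
    using heights_I[of c 0 "c * c - 1" 1] that lorentz_form_unit_sphere_vector[of "c *\<^sub>R e"]
    by (simp add: unit_sphere_vector_def e)
  have s1: "heights G e s 1"
    using sphere_s[of 0] by (intro unit) simp
  define \<sigma> where "\<sigma> = sgn s"
  have \<sigma>: "\<sigma> = 1 \<or> \<sigma> = -1"
    using s by (auto simp: \<sigma>_def sgn_if)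
  have "heights G e \<sigma> 1"
    using heights_dilate[OF s1, of "1 / \<bar>s\<bar>"] s by (simp add: \<sigma>_def real_sgn_eq)
  then have "heights G e (\<sigma> / 4) 1"
    using heights_dilate[of \<sigma> "1 / 4"] by simp
  \<comment> \<open>Dilations keep the sign of the height. Crossing the hyperplane takes unequal
    heights: squared distance 3/2 gives \<sigma>/4 - \<sigma>/2, and 3/2 exceeds the squared height
    difference 9/16.\<close>
  have neg: "heights G e (- \<sigma> / 4) 1"
    using heights_invert[OF \<open>heights G e \<sigma> 1\<close> \<open>heights G e (\<sigma> / 4) 1\<close>, of "3 / 2"] \<sigma>
    by (auto simp: power2_eq_square)
  have "heights G e y 1"
  proof (cases "y = 0")
    case True
    then show ?thesis
      using sphere_0[of 0] by (intro unit) simp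
  next
    case False
    then have "y = \<bar>y\<bar> * \<sigma> \<or> y = (4 * \<bar>y\<bar>) * (- \<sigma> / 4)"
      using \<sigma> by (auto simp: abs_if)
    then show ?thesis
      using heights_dilate[OF \<open>heights G e \<sigma> 1\<close>, of "\<bar>y\<bar>"] heights_dilate[OF neg, of "4 * \<bar>y\<bar>"] False
      by (metis mult_pos_pos zero_less_abs_iff zero_less_numeral)
  qed
  then show ?thesis
    using heights_scale assms by simp
qed

lemma all_reflections:
  assumes "lorentz_form v v = 1"
  shows "v \<in> N"
proof -
  have pos: "lightcone x p q \<in> N" if "q > 0" "lorentz_form (lightcone x p q) (lightcone x p q) = 1" for x p q
  proof -
    define h where "h = x - (x \<bullet> e) *\<^sub>R e"
    have h: "h \<bullet> e = 0" "x = (x \<bullet> e) *\<^sub>R e + h"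
      by (simp_all add: h_def inner_diff_left e)
    then show ?thesis
      using heights_all[OF that(1), of "x \<bullet> e"] that(2) by (metis (no_types, lifting) heights_D form_1_iff)
  qed
  have nonzero: "lightcone x p q \<in> N" if "q \<noteq> 0" "lorentz_form (lightcone x p q) (lightcone x p q) = 1" for x p q
  proof (cases "q > 0")
    case False
    then have "lightcone (- x) (- p) (- q) \<in> N"
      using that by (intro pos) (simp_all add: lorentz_form_lightcone)
    then show ?thesis
      using uminus_mem_N[of "lightcone x p q"] by (simp add: lightcone_arith)
  qed (use pos that in blast)
  obtain x p q where v: "v = lightcone x p q"
    by (rule lightcone_cases)
  show ?thesis
  proof (cases "q = 0")
    case True
    have x: "x \<bullet> x = 1"
      using assms by (simp add: v True lorentz_form_lightcone)
    \<comment> \<open>For \<open>q = 0\<close> the vector describes a Euclidean hyperplane instead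
      of a sphere. Inverting in the unit sphere centered at \<open>c *\<^sub>R x\<close> makes its
      last coordinate \<open>p - 2 * c\<close>; the sign of \<open>c\<close> keeps this
      nonzero.\<close>
    define c :: real where "c = (if p < 0 then 1 else -1)"
    have c: "c * c = 1" "c \<noteq> p / 2"
      by (auto simp: c_def)
    define w where "w = lightcone (c *\<^sub>R x) 0 1"
    have w: "lorentz_form w w = 1"
      using x c(1) by (simp add: w_def lorentz_form_lightcone)
    have "blinfun_apply (reflection w) v =
        lightcone (x - (2 * c - p) *\<^sub>R c *\<^sub>R x) p (p - 2 * c)"
      using x by (simp add: reflection_apply w_def v True lorentz_form_lightcone lightcone_arith
          lightcone_eq_iff)
    then have "blinfun_apply (reflection w) v \<in> N"
      using nonzero[of "p - 2 * c"] c(2) lorentz_form_reflection[OF w, of v v] assms by auto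
    moreover have "w \<in> N"
      using nonzero[of 1] w by (simp add: w_def)
    ultimately show ?thesis
      using reflection_mem_N[of w "blinfun_apply (reflection w) v"] by (simp add: reflection_reflection[OF w])
  qed (use nonzero assms v in blast)
qed

lemma O_plus_subset: "O_plus \<subseteq> G"
  by (rule O_plus_subset_if_reflections) (use one comp all_reflections in auto)

end

section \<open>The generators as Lorentz transformations\<close>

lemma translation_eq: "z \<in> upper_half_space \<Longrightarrow> translation h z = (fst z + h, snd z)"
  by (simp add: translation_def prod_eq_iff)

lemma to_hyperboloid_translation:
  assumes "z \<in> upper_half_space"
  shows "to_hyperboloid (translation h z) = blinfun_apply (lorentz_translation h) (to_hyperboloid z)"
proof -
  have "(fst z + h, snd z) \<in> upper_half_space" and t: "snd z > 0"
    using assms by (simp_all add: upper_half_space_def)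
  then show ?thesis
    unfolding translation_eq[OF assms] to_hyperboloid_lightcone[OF assms] lorentz_translation_apply
    using inner_commute[of h "fst z"]
    by (simp add: to_hyperboloid_lightcone norm_power2_prod lightcone_eq_iff scaleR_add_right
        inner_add_left inner_add_right add_divide_distrib)
qed

lemma translation_uminus_cancel:
  assumes "z \<in> upper_half_space"
  shows "translation (- h) (translation h z) = z"
proof -
  have "(fst z + h, snd z) \<in> upper_half_space"
    using assms by (simp add: upper_half_space_def)
  then show ?thesis
    by (simp add: translation_eq assms)
qed

lemma translation_in_Isom:
  fixes h :: "'a::euclidean_space"
  shows "translation h \<in> Isom"
proof (rule IsomI[where f' = "translation (- h)"])
  show "translation h (translation (- h) z) = z" "translation (- h) (translation h z) = z"
    if "z \<in> upper_half_space" for z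
    using translation_uminus_cancel[OF that] translation_uminus_cancel[OF that, of "- h"] by simp_all
  show "translation h \<in> extensional upper_half_space"
    by (simp add: translation_def)
qed (use translation_eq to_hyperboloid_translation lorentz_translation_in_O_plus in
    \<open>auto simp: translation_def upper_half_space_def\<close>)

lemma lorentz_rep_translation: "lorentz_rep (translation h) = lorentz_translation h"
  by (rule lorentz_rep_eqI) (simp_all add: lorentz_translation_in_O_plus to_hyperboloid_translation)

lemma inversion_eq:
  fixes z :: "'a::euclidean_space \<times> real" and c :: 'a
  assumes "z \<in> upper_half_space"
  defines "r \<equiv> (fst z - c) \<bullet> (fst z - c) + (snd z)\<^sup>2"
  shows "inversion c z = (c + (1 / r) *\<^sub>R (fst z - c), snd z / r)" "r > 0"
proof -
  show "r > 0"
    using assms(1) by (simp add: r_def upper_half_space_def add_nonneg_pos)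
  have "(dist z (c, 0))\<^sup>2 = r"
    by (simp add: dist_norm norm_power2_prod r_def)
  then show "inversion c z = (c + (1 / r) *\<^sub>R (fst z - c), snd z / r)"
    using assms(1) by (simp add: inversion_def prod_eq_iff)
qed

lemma inversion_in_upper_half_space:
  assumes "z \<in> upper_half_space"
  shows "inversion c z \<in> upper_half_space"
  using inversion_eq[OF assms, of c] assms by (simp add: upper_half_space_def)

lemma inversion_inversion:
  assumes "z \<in> upper_half_space"
  shows "inversion c (inversion c z) = z"
proof -
  define r where "r = (fst z - c) \<bullet> (fst z - c) + (snd z)\<^sup>2"
  define w where "w = inversion c z"
  note inv = inversion_eq[OF assms, of c, folded r_def w_def]
  have w: "w \<in> upper_half_space"
    unfolding w_def by (rule inversion_in_upper_half_space[OF assms])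
  have "(fst w - c) \<bullet> (fst w - c) + (snd w)\<^sup>2 = ((fst z - c) \<bullet> (fst z - c) + (snd z)\<^sup>2) / r\<^sup>2"
    by (simp add: inv(1) power_divide power2_eq_square add_divide_distrib)
  also have "\<dots> = 1 / r"
    using inv(2) unfolding r_def[symmetric] by (simp add: power2_eq_square)
  finally have "inversion c w = (c + (1 / (1 / r)) *\<^sub>R (fst w - c), snd w / (1 / r))"
    using inversion_eq(1)[OF w, of c] by simp
  then show ?thesis
    using inv(2) unfolding w_def[symmetric] by (simp add: inv(1))
qed

text \<open>With \<open>r\<close> the squared distance to the center, inversion divides the height
  by \<open>r\<close>. The reflection coefficient is \<open>(1 - r) / t\<close>, which vanishes
  exactly on the sphere.\<close>

lemma to_hyperboloid_inversion:
  assumes "z \<in> upper_half_space"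
  shows "to_hyperboloid (inversion c z) =
    blinfun_apply (reflection (unit_sphere_vector c)) (to_hyperboloid z)"
proof -
  define x t where "x = fst z" and "t = snd z"
  define r where "r = (x - c) \<bullet> (x - c) + t\<^sup>2"
  have inv: "inversion c z = (c + (1 / r) *\<^sub>R (x - c), t / r)" "r > 0" and t: "t > 0"
    using inversion_eq[OF assms, of c] assms
    by (simp_all add: r_def x_def t_def upper_half_space_def)
  have r: "r = x \<bullet> x + t\<^sup>2 - 2 * (x \<bullet> c) + c \<bullet> c"
    by (simp add: r_def inner_diff_left inner_diff_right inner_commute)
  have xc: "(x - c) \<bullet> (x - c) = r - t\<^sup>2" "c \<bullet> (x - c) = x \<bullet> c - c \<bullet> c"
    by (simp_all add: r_def inner_diff_right inner_commute)
  have norm_inv: "(norm (inversion c z))\<^sup>2 = c \<bullet> c + (2 * (x \<bullet> c - c \<bullet> c) + 1) / r"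
  proof -
    have "(norm (inversion c z))\<^sup>2 =
        c \<bullet> c + (2 / r) * (c \<bullet> (x - c)) + (1 / r)\<^sup>2 * ((x - c) \<bullet> (x - c)) + (t / r)\<^sup>2"
      unfolding norm_power2_prod inv(1)
      by (simp add: inner_add_left inner_add_right inner_commute[of "x - c" c] power2_eq_square
          add_divide_distrib)
    also have "\<dots> = c \<bullet> c + (2 * (x \<bullet> c - c \<bullet> c) + 1) / r"
      unfolding xc using inv(2) by (simp add: field_simps power2_eq_square)
    finally show ?thesis .
  qed
  have lhs: "to_hyperboloid (inversion c z) =
      lightcone ((r / t) *\<^sub>R c + (1 / t) *\<^sub>R (x - c)) ((r * (c \<bullet> c) + 2 * (x \<bullet> c - c \<bullet> c) + 1) / t) (r / t)"
    unfolding to_hyperboloid_lightcone[OF inversion_in_upper_half_space[OF assms]] norm_inv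
    using inv t by (simp add: lightcone_eq_iff scaleR_add_right field_simps)
  have z: "to_hyperboloid z = lightcone ((1 / t) *\<^sub>R x) ((x \<bullet> x + t\<^sup>2) / t) (1 / t)"
    using to_hyperboloid_lightcone[OF assms] by (simp add: norm_power2_prod x_def t_def)
  have form: "2 * lorentz_form (to_hyperboloid z) (unit_sphere_vector c) = (1 - r) / t"
    unfolding z unit_sphere_vector_def lorentz_form_lightcone r using t by (simp add: field_simps)
  have "(1 / t) *\<^sub>R x - ((1 - r) / t) *\<^sub>R c = (r / t) *\<^sub>R c + (1 / t) *\<^sub>R (x - c)"
    by (simp add: algebra_simps diff_divide_distrib)
  moreover have "(x \<bullet> x + t\<^sup>2) / t - (1 - r) / t * (c \<bullet> c - 1) = (r * (c \<bullet> c) + 2 * (x \<bullet> c - c \<bullet> c) + 1) / t"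
    using t by (simp add: r field_simps)
  moreover have "1 / t - (1 - r) / t * 1 = r / t"
    using t by (simp add: field_simps)
  ultimately show ?thesis
    unfolding lhs reflection_apply form unfolding z unit_sphere_vector_def lightcone_arith
    by (simp add: lightcone_eq_iff)
qed

lemma inversion_in_Isom: "inversion c \<in> Isom"
  by (rule IsomI[where f' = "inversion c" and g = "reflection (unit_sphere_vector c)"])
    (simp_all add: inversion_in_upper_half_space inversion_inversion to_hyperboloid_inversion
      reflection_in_O_plus lorentz_form_unit_sphere_vector, simp add: inversion_def)

lemma lorentz_rep_inversion: "lorentz_rep (inversion c) = reflection (unit_sphere_vector c)"
  by (rule lorentz_rep_eqI)
    (simp_all add: to_hyperboloid_inversion reflection_in_O_plus lorentz_form_unit_sphere_vector)

lemma inv_translation: "inv\<^bsub>Isom_group\<^esub> (translation h) = translation (- h)"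
proof (rule group.inv_equality[OF group_Isom_group])
  show "translation (- h) \<otimes>\<^bsub>Isom_group\<^esub> translation h = \<one>\<^bsub>Isom_group\<^esub>"
    by (auto simp: mult_Isom_group translation_in_Isom one_Isom_group compose_def
        translation_uminus_cancel intro!: restrict_ext)
qed (simp_all add: translation_in_Isom)

lemma inv_inversion: "inv\<^bsub>Isom_group\<^esub> (inversion c) = inversion c"
proof (rule group.inv_equality[OF group_Isom_group])
  show "inversion c \<otimes>\<^bsub>Isom_group\<^esub> inversion c = \<one>\<^bsub>Isom_group\<^esub>"
    by (auto simp: mult_Isom_group inversion_in_Isom one_Isom_group compose_def inversion_inversion
        intro!: restrict_ext)
qed (simp_all add: inversion_in_Isom)

section \<open>Zariski closures\<close>

text \<open>The Zariski closure in the ambient vector space rather than inside \<open>Isom\<close>,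
  so that curves and one-sided multiplications can be treated as polynomial maps.\<close>

definition polynomial_hull :: "'v::real_normed_vector set \<Rightarrow> 'v set" where
  "polynomial_hull X = {g. \<forall>p. real_polynomial_function p \<longrightarrow> (\<forall>x\<in>X. p x = 0) \<longrightarrow> p g = 0}"

lemma subset_polynomial_hull: "X \<subseteq> polynomial_hull X"
  by (auto simp: polynomial_hull_def)

text \<open>Polynomial maps are Zariski continuous: pull the equations back along
  \<open>f\<close>.\<close>

lemma polynomial_hull_map:
  assumes "polynomial_function f" "\<And>x. x \<in> X \<Longrightarrow> f x \<in> polynomial_hull Y" "g \<in> polynomial_hull X"
  shows "f g \<in> polynomial_hull Y"
  unfolding polynomial_hull_def
proof (intro CollectI allI impI)
  fix p :: "_ \<Rightarrow> real" assume p: "real_polynomial_function p" "\<forall>y\<in>Y. p y = 0"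
  have "real_polynomial_function (p \<circ> f)"
    using assms(1) p(1) by (rule real_polynomial_function_compose)
  moreover have "\<forall>x\<in>X. (p \<circ> f) x = 0"
    using assms(2) p by (auto simp: polynomial_hull_def)
  ultimately show "p (f g) = 0"
    using assms(3) by (auto simp: polynomial_hull_def)
qed

text \<open>The usual two-step argument: vary the right factor with the left one in
  \<open>X\<close>, then vary the left factor with the right one in the hull.\<close>

lemma blinfun_compose_polynomial_hull:
  fixes X :: "('v::real_normed_vector \<Rightarrow>\<^sub>L 'v) set"
  assumes X: "\<And>g h. g \<in> X \<Longrightarrow> h \<in> X \<Longrightarrow> g o\<^sub>L h \<in> X"
    and "g \<in> polynomial_hull X" "h \<in> polynomial_hull X"
  shows "g o\<^sub>L h \<in> polynomial_hull X"
proof (rule polynomial_hull_map[where f = "\<lambda>g. g o\<^sub>L h", OF _ _ assms(2)])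
  show "polynomial_function (\<lambda>g::'v \<Rightarrow>\<^sub>L 'v. g o\<^sub>L h)" for h :: "'v \<Rightarrow>\<^sub>L 'v"
    by (intro polynomial_function_bounded_linear bounded_bilinear.bounded_linear_left
        bounded_bilinear_blinfun_compose)
  have "polynomial_function (\<lambda>h::'v \<Rightarrow>\<^sub>L 'v. g o\<^sub>L h)" for g :: "'v \<Rightarrow>\<^sub>L 'v"
    by (intro polynomial_function_bounded_linear bounded_bilinear.bounded_linear_right
        bounded_bilinear_blinfun_compose)
  then show "g o\<^sub>L h \<in> polynomial_hull X" if "g \<in> X" for g
    by (rule polynomial_hull_map[OF _ _ assms(3)]) (use X that subset_polynomial_hull in blast)
qed

lemma polynomial_hull_Nats: "polynomial_hull (range real) = UNIV"
proof -
  have "p t = 0" if p: "real_polynomial_function p" and nat: "\<And>n. p (real n) = 0" for p :: "real \<Rightarrow> real" and t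
  proof -
    obtain a n where p_eq: "p = (\<lambda>x. \<Sum>i\<le>n. a i * x ^ i)"
      using real_polynomial_function_imp_sum[OF p] by blast
    have "range real \<subseteq> {x. (\<Sum>i\<le>n. a i * x ^ i) = 0}"
      using nat by (auto simp: p_eq)
    moreover have "infinite (range real)"
      by (simp add: finite_image_iff inj_on_def)
    ultimately have "\<not> (\<exists>i\<le>n. a i \<noteq> 0)"
      using polyfun_finite_roots[of a n] infinite_super by blast
    then show ?thesis
      by (simp add: p_eq)
  qed
  then have "t \<in> polynomial_hull (range real)" for t
    unfolding polynomial_hull_def by blast
  then show ?thesis
    by blast
qed

lemma zariski_closure_eq_Isom:
  fixes X :: "('a::euclidean_space \<times> real \<Rightarrow> 'a \<times> real) set"
  assumes "X \<subseteq> Isom" "O_plus \<subseteq> polynomial_hull (lorentz_rep ` X)"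
  shows "zariski_closure X = Isom"
proof
  have "zariski_closed (Isom :: ('a \<times> real \<Rightarrow> 'a \<times> real) set)"
    unfolding zariski_closed_def by (intro exI[of _ "{}"]) auto
  then show "zariski_closure X \<subseteq> Isom"
    using assms(1) unfolding zariski_closure_def by blast
  show "Isom \<subseteq> zariski_closure X"
    unfolding zariski_closure_def
  proof (intro subsetI InterI)
    fix f C assume f: "f \<in> (Isom :: ('a \<times> real \<Rightarrow> 'a \<times> real) set)" and "C \<in> {C. zariski_closed C \<and> X \<subseteq> C}"
    then obtain P where P: "P \<subseteq> Collect real_polynomial_function" "X \<subseteq> C"
      "C = {f \<in> Isom. \<forall>p\<in>P. p (lorentz_rep f) = 0}"
      unfolding zariski_closed_def by blast
    have "p (lorentz_rep f) = 0" if "p \<in> P" for p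
      using assms(2) lorentz_rep_Isom(1)[OF f] that P unfolding polynomial_hull_def by blast
    then show "f \<in> C"
      using P(3) f by blast
  qed
qed

lemma lorentz_translation_polynomial_hull:
  fixes X :: "('a::euclidean_space lorentz \<Rightarrow>\<^sub>L 'a lorentz) set"
  assumes comp: "\<And>g h. g \<in> X \<Longrightarrow> h \<in> X \<Longrightarrow> g o\<^sub>L h \<in> X" and one: "id_blinfun \<in> X"
    and S: "\<And>h. h \<in> S \<Longrightarrow> lorentz_translation h \<in> X" and "h \<in> span S"
  shows "lorentz_translation h \<in> polynomial_hull X"
  using assms(4)
proof (induction rule: span_induct_alt)
  case base
  show ?case
    using lorentz_translation_scaleR[of 0 "0 :: 'a"] one subset_polynomial_hull by auto
next
  case (step c b y)
  have poly: "polynomial_function (\<lambda>t. lorentz_translation (t *\<^sub>R b))"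
    unfolding lorentz_translation_scaleR
    by (intro polynomial_function_add polynomial_function_mult polynomial_function_const
        polynomial_function_id) (simp flip: real_polynomial_function_eq, force)
  have "lorentz_translation (real n *\<^sub>R b) \<in> X" for n
  proof (induction n)
    case 0
    then show ?case
      using lorentz_translation_scaleR[of 0 b] one by simp
  next
    case (Suc n)
    then show ?case
      using comp S[OF step(1)] by (simp add: scaleR_left_distrib lorentz_translation_add)
  qed
  then have "lorentz_translation (c *\<^sub>R b) \<in> polynomial_hull X"
    using polynomial_hull_map[OF poly, of "range real" X c] subset_polynomial_hull[of X]
    by (auto simp: polynomial_hull_Nats)
  then show ?case
    unfolding lorentz_translation_add using blinfun_compose_polynomial_hull[OF comp] step(2) by blast
qed

section \<open>Discreteness\<close>

text \<open>Integrality is imposed in light-cone coordinates, in which the vectors of unit spheres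
  centered on the lattice are themselves lattice vectors.\<close>

definition lorentz_lattice :: "'a::euclidean_space set \<Rightarrow> 'a lorentz set" where
  "lorentz_lattice \<Lambda> = {v. fst v \<in> \<Lambda> \<and> lightcone_p v \<in> \<int> \<and> lightcone_q v \<in> \<int>}"

lemma lightcone_in_lorentz_lattice [simp]:
  "lightcone x p q \<in> lorentz_lattice \<Lambda> \<longleftrightarrow> x \<in> \<Lambda> \<and> p \<in> \<int> \<and> q \<in> \<int>"
  by (simp add: lorentz_lattice_def)

locale integral_lattice =
  fixes \<Lambda> :: "'a::euclidean_space set"
  assumes zero: "0 \<in> \<Lambda>" and diff: "\<And>x y. x \<in> \<Lambda> \<Longrightarrow> y \<in> \<Lambda> \<Longrightarrow> x - y \<in> \<Lambda>"
    and span: "span \<Lambda> = UNIV"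
    and integral: "\<And>x. x \<in> \<Lambda> \<Longrightarrow> x \<bullet> x \<in> \<int>"
begin

lemma add: "x \<in> \<Lambda> \<Longrightarrow> y \<in> \<Lambda> \<Longrightarrow> x + y \<in> \<Lambda>"
  using diff[of x "0 - y"] diff[OF zero, of y] by simp

lemma scale:
  assumes "c \<in> \<int>" "x \<in> \<Lambda>"
  shows "c *\<^sub>R x \<in> \<Lambda>"
proof -
  obtain i where i: "c = of_int i"
    using assms(1) by (auto elim: Ints_cases)
  have "of_int i *\<^sub>R x \<in> \<Lambda>"
    by (induction i rule: int_induct[where k = 0])
      (use zero diff add assms(2) in \<open>auto simp: scaleR_left_distrib scaleR_left_diff_distrib\<close>)
  then show ?thesis
    by (simp add: i)
qed

text \<open>Polarization only controls twice the inner product. The factor 2 in the formulas for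
  reflections and translations makes this sufficient.\<close>

lemma twice_inner_Ints:
  assumes "x \<in> \<Lambda>" "y \<in> \<Lambda>"
  shows "2 * (x \<bullet> y) \<in> \<int>"
proof -
  have "2 * (x \<bullet> y) = (x + y) \<bullet> (x + y) - x \<bullet> x - y \<bullet> y"
    by (simp add: inner_add_left inner_add_right inner_commute)
  then show ?thesis
    using integral add assms by auto
qed

lemma lattice_diff:
  assumes "v \<in> lorentz_lattice \<Lambda>" "w \<in> lorentz_lattice \<Lambda>"
  shows "v - w \<in> lorentz_lattice \<Lambda>"
proof -
  obtain x p q x' p' q' where "v = lightcone x p q" "w = lightcone x' p' q'"
    by (metis lightcone_cases)
  then show ?thesis
    using assms diff by (simp add: lightcone_arith)
qed

lemma translation_preserves_lattice:
  assumes "h \<in> \<Lambda>" "v \<in> lorentz_lattice \<Lambda>"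
  shows "blinfun_apply (lorentz_translation h) v \<in> lorentz_lattice \<Lambda>"
proof -
  obtain x p q where "v = lightcone x p q"
    by (rule lightcone_cases)
  then show ?thesis
    using assms twice_inner_Ints[of x h] integral[of h]
    by (auto simp: lorentz_translation_apply intro!: add scale)
qed

lemma inversion_preserves_lattice:
  assumes "c \<in> \<Lambda>" "v \<in> lorentz_lattice \<Lambda>"
  shows "blinfun_apply (reflection (unit_sphere_vector c)) v \<in> lorentz_lattice \<Lambda>"
proof -
  obtain x p q where v: "v = lightcone x p q"
    by (rule lightcone_cases)
  define k where "k = 2 * lorentz_form v (unit_sphere_vector c)"
  have "k = 2 * (x \<bullet> c) - (p + q * (c \<bullet> c - 1))"
    by (simp add: k_def v unit_sphere_vector_def lorentz_form_lightcone field_simps)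
  then have k: "k \<in> \<int>"
    using assms twice_inner_Ints[of x c] integral[of c] by (simp add: v)
  then show ?thesis
    unfolding reflection_apply k_def[symmetric]
    using assms integral[of c] by (auto simp: v unit_sphere_vector_def lightcone_arith intro!: diff scale)
qed

text \<open>The null coordinates are a sum and a difference of two coordinates below 1/2, hence
  integers below 1 in absolute value; so is the square of the vector part.\<close>

lemma short_lattice_vector:
  assumes "v \<in> lorentz_lattice \<Lambda>" "norm v < 1 / 2"
  shows "v = 0"
proof -
  have x: "norm (fst v) < 1 / 2" and a: "\<bar>fst (snd v)\<bar> < 1 / 2" and b: "\<bar>snd (snd v)\<bar> < 1 / 2"
    using assms(2) norm_fst_le[of "fst v" "snd v"] norm_snd_le[of "snd v" "fst v"]
      norm_fst_le[of "fst (snd v)" "snd (snd v)"] norm_snd_le[of "snd (snd v)" "fst (snd v)"]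
    unfolding real_norm_def[symmetric] prod.collapse by linarith+
  have small: "r = 0" if "r \<in> \<int>" "\<bar>r\<bar> < 1" for r :: real
    using that by (auto elim!: Ints_cases)
  have "(norm (fst v))\<^sup>2 < 1"
    using x by (simp add: power_less_one_iff abs_square_less_1)
  then have "fst v = 0"
    using small[of "fst v \<bullet> fst v"] integral[of "fst v"] assms(1)
    by (simp add: lorentz_lattice_def power2_norm_eq_inner)
  moreover have "lightcone_p v = 0" "lightcone_q v = 0"
    using small[of "lightcone_p v"] small[of "lightcone_q v"] assms(1) a b
    by (simp_all add: lorentz_lattice_def lightcone_p_def lightcone_q_def)
  ultimately have "v = lightcone 0 0 0"
    using lightcone_eta[of v] by simp
  then show ?thesis
    by (simp add: lightcone_def prod_eq_iff)
qed

lemma span_lorentz_lattice: "span (lorentz_lattice \<Lambda>) = UNIV"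
proof -
  have x: "lightcone x 0 0 \<in> span (lorentz_lattice \<Lambda>)" for x
  proof -
    have "x \<in> span \<Lambda>"
      using span by simp
    then show ?thesis
    proof (induction rule: span_induct_alt)
      case base
      then show ?case
        using zero by (simp add: span_base)
    next
      case (step c y z)
      have "lightcone (c *\<^sub>R y + z) 0 0 = c *\<^sub>R lightcone y 0 0 + lightcone z 0 0"
        by (simp add: lightcone_arith)
      then show ?case
        using step by (simp add: span_add span_mul span_base)
    qed
  qed
  have "lightcone x p q \<in> span (lorentz_lattice \<Lambda>)" for x p q
  proof -
    have "lightcone x p q = lightcone x 0 0 + (p *\<^sub>R lightcone 0 1 0 + q *\<^sub>R lightcone 0 0 1)"
      by (simp add: lightcone_arith)
    then show ?thesis
      using x zero by (simp add: span_add span_mul span_base)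
  qed
  then show ?thesis
    by (metis UNIV_eq_I lightcone_cases)
qed

lemma discrete_if_preserves_lattice:
  fixes X :: "('a lorentz \<Rightarrow>\<^sub>L 'a lorentz) set"
  assumes "\<And>g v. g \<in> X \<Longrightarrow> v \<in> lorentz_lattice \<Lambda> \<Longrightarrow> blinfun_apply g v \<in> lorentz_lattice \<Lambda>"
  shows "discrete X"
proof -
  obtain B where B: "B \<subseteq> lorentz_lattice \<Lambda>" "independent B" "lorentz_lattice \<Lambda> \<subseteq> span B"
    using maximal_independent_subset by blast
  have fin: "finite B"
    using B(2) independent_imp_finite by blast
  have spanB: "span B = UNIV"
    by (metis B(3) span_lorentz_lattice span_mono span_span top.extremum_uniqueI)
  \<comment> \<open>Closer than \<epsilon>, two maps differ by less than 1/2 on every basis vector,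
    hence agree there; the summand 1 keeps the denominator positive.\<close>
  define \<epsilon> where "\<epsilon> = 1 / (2 * (1 + (\<Sum>b\<in>B. norm b)))"
  have S: "0 \<le> (\<Sum>b\<in>B. norm b)"
    by (simp add: sum_nonneg)
  have eq: "g = h" if g: "g \<in> X" and h: "h \<in> X" and near: "dist g h < \<epsilon>" for g h
  proof (rule blinfun_eqI)
    have on_B: "blinfun_apply g b = blinfun_apply h b" if b: "b \<in> B" for b
    proof -
      have "norm b \<le> (\<Sum>b\<in>B. norm b)"
        using fin b by (simp add: member_le_sum)
      have "norm (blinfun_apply (g - h) b) \<le> norm (g - h) * norm b"
        by (rule norm_blinfun)
      also have "\<dots> \<le> dist g h * (1 + (\<Sum>b\<in>B. norm b))"
        unfolding dist_norm using \<open>norm b \<le> _\<close> by (intro mult_left_mono) auto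
      also have "\<dots> < \<epsilon> * (1 + (\<Sum>b\<in>B. norm b))"
        using near S by (intro mult_strict_right_mono) auto
      also have "\<dots> = 1 / 2"
        using S by (simp add: \<epsilon>_def)
      finally have "norm (blinfun_apply g b - blinfun_apply h b) < 1 / 2"
        by (simp add: blinfun.diff_left)
      moreover have "b \<in> lorentz_lattice \<Lambda>"
        using b B(1) by blast
      then have "blinfun_apply g b - blinfun_apply h b \<in> lorentz_lattice \<Lambda>"
        by (intro lattice_diff assms g h)
      ultimately show ?thesis
        using short_lattice_vector right_minus_eq by blast
    qed
    show "blinfun_apply g v = blinfun_apply h v" for v :: "'a lorentz"
      by (rule linear_eq_on_span[where B = B])
        (simp_all add: on_B spanB bounded_linear.linear blinfun.bounded_linear_right)
  qed
  have "\<epsilon> > 0"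
    using S by (simp add: \<epsilon>_def)
  then have "g isolated_in X" if "g \<in> X" for g
    unfolding isolated_in_dist_Ex_iff using eq[OF that] that by (metis)
  then show ?thesis
    by (rule discreteI)
qed

end

section \<open>The group \<open>\<Gamma>\<^sub>u\<close>\<close>

lemma group_closure_subset_span: "group_closure S \<subseteq> span S"
proof
  show "x \<in> span S" if "x \<in> group_closure S" for x
    using that by induction (auto intro: span_base span_diff span_zero)
qed

locale covering_setup =
  fixes n :: nat and R :: "quat set" and \<iota> :: "'a::euclidean_space \<Rightarrow> quat" and u \<tau> :: quat
  assumes ring: "admissible_ring n R"
    and \<iota>: "boundary_identification n R \<iota>"
    and u: "u \<in> plus_part n R" "u \<noteq> 0" "qRe u = 0"
    and \<tau>: "complementary_vector n R u \<tau>"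
begin

definition \<Lambda> :: "'a set" where
  "\<Lambda> = \<iota> -` plus_part n R"

definition \<Lambda>0 :: "'a set" where
  "\<Lambda>0 = \<iota> -` (plus_part n R \<inter> hyperplane n R u)"

lemma linear_\<iota>: "linear \<iota>"
  using \<iota> by (simp add: boundary_identification_def)

lemma inner_\<iota>: "\<iota> x \<bullet> \<iota> y = x \<bullet> y"
proof -
  have "norm (\<iota> x) = norm x" for x
    using \<iota> by (simp add: boundary_identification_def norm_eq_sqrt_nrm[of "\<iota> x"])
  then show ?thesis
    by (simp add: dot_norm linear_add[OF linear_\<iota>, symmetric])
qed

lemma \<iota>_eq_iff: "\<iota> x = \<iota> y \<longleftrightarrow> x = y"
proof -
  have "(x - y) \<bullet> (x - y) = (\<iota> x - \<iota> y) \<bullet> (\<iota> x - \<iota> y)"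
    by (simp add: inner_\<iota>[symmetric] linear_diff[OF linear_\<iota>])
  then show ?thesis
    by auto
qed

lemma range_\<iota>: "range \<iota> = real_plus_part n R"
  using \<iota> by (simp add: boundary_identification_def)

lemma plus_part_subset_range: "plus_part n R \<subseteq> range \<iota>"
  unfolding range_\<iota> real_plus_part_def by (auto intro: span_base)

lemma plus_part_eq: "plus_part n R = group_closure (insert \<tau> (hyperplane n R u \<inter> plus_part n R))"
  using \<tau> by (simp add: complementary_vector_def)

text \<open>That \<open>plus_part n R\<close> is a group is read off from its presentation by \<tau>
  and the hyperplane, uniformly in the dimension.\<close>

sublocale integral_lattice \<Lambda>
proof
  show "0 \<in> \<Lambda>"
    unfolding \<Lambda>_def using linear_0[OF linear_\<iota>] plus_part_eq by (metis vimageI2 zero_in_group_closure)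
  show "x - y \<in> \<Lambda>" if "x \<in> \<Lambda>" "y \<in> \<Lambda>" for x y
    using that unfolding \<Lambda>_def vimage_eq linear_diff[OF linear_\<iota>]
    by (metis group_closure.diff plus_part_eq)
  show "x \<bullet> x \<in> \<int>" if "x \<in> \<Lambda>" for x
    using that nrm_admissible_ring_Ints[OF ring, of "\<iota> x"] plus_part_subset
    by (auto simp: \<Lambda>_def nrm_eq_inner inner_\<iota>)
  have "\<iota> ` \<Lambda> = plus_part n R"
    unfolding \<Lambda>_def using plus_part_subset_range by (simp add: image_vimage_eq Int_absorb2)
  then have "\<iota> ` span \<Lambda> = range \<iota>"
    unfolding range_\<iota> real_plus_part_def using linear_span_image[OF linear_\<iota>] by metis
  then show "span \<Lambda> = UNIV"
    using \<iota>_eq_iff by (metis UNIV_eq_I image_iff rangeI)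
qed

definition u0 :: 'a where
  "u0 = (SOME x. \<iota> x = u)"

lemma u0: "\<iota> u0 = u"
  unfolding u0_def by (rule someI_ex) (use plus_part_subset_range u(1) in \<open>metis rangeE subsetD\<close>)

definition \<tau>0 :: 'a where
  "\<tau>0 = (SOME x. \<iota> x = \<tau>)"

lemma \<tau>0: "\<iota> \<tau>0 = \<tau>"
  unfolding \<tau>0_def
  by (rule someI_ex) (use plus_part_subset_range \<tau> in \<open>metis complementary_vector_def rangeE subsetD\<close>)

text \<open>\<tau> and the lattice points of the hyperplane span everything, and pairing with
  \<open>u\<close> kills the coefficient of \<tau>. This turns lattice translations into all real
  ones along the hyperplane.\<close>

lemma span_\<Lambda>0:
  assumes "h \<bullet> u0 = 0"
  shows "h \<in> span \<Lambda>0"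
proof -
  let ?H = "hyperplane n R u \<inter> plus_part n R"
  have "\<iota> h \<in> span (plus_part n R)"
    using range_\<iota> by (auto simp: real_plus_part_def)
  moreover have "plus_part n R \<subseteq> span (insert \<tau> ?H)"
    using group_closure_subset_span[of "insert \<tau> ?H"] plus_part_eq by simp
  ultimately have "\<iota> h \<in> span (insert \<tau> ?H)"
    by (metis in_mono span_mono span_span)
  then obtain k where k: "\<iota> h - k *\<^sub>R \<tau> \<in> span ?H"
    by (auto simp: span_breakdown_eq)
  have "span ?H \<subseteq> {x. x \<bullet> u = 0}"
    by (rule span_minimal) (auto simp: hyperplane_def subspace_def inner_add_left)
  then have "k * (\<tau> \<bullet> u) = 0"
    using k assms inner_\<iota>[of h u0] by (auto simp: u0 inner_diff_left)
  moreover have "\<tau> \<bullet> u > 0"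
    using \<tau> by (simp add: complementary_vector_def hyperplane_interior_def)
  ultimately have "\<iota> h \<in> span ?H"
    using k by simp
  also have "?H = \<iota> ` \<Lambda>0"
    unfolding \<Lambda>0_def using plus_part_subset_range by (auto simp: image_vimage_eq)
  finally show ?thesis
    unfolding linear_span_image[OF linear_\<iota>] using \<iota>_eq_iff by auto
qed

lemma Gamma_generators_cases:
  assumes "f \<in> Gamma_u_generators n R \<iota> u \<tau>"
  obtains (translation) h where "h \<in> \<Lambda>" "f = translation h"
    | (inversion) c where "c \<in> \<Lambda>" "f = inversion c"
  using assms unfolding Gamma_u_generators_def \<Lambda>_def by blast

lemma Gamma_generators_subset_Isom: "Gamma_u_generators n R \<iota> u \<tau> \<subseteq> Isom"
  using Gamma_generators_cases translation_in_Isom inversion_in_Isom by (metis subsetI)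

lemma subgroup_Gamma: "subgroup (Gamma_u n R \<iota> u \<tau>) Isom_group"
  unfolding Gamma_u_def
  by (rule group.generate_is_subgroup[OF group_Isom_group]) (simp add: Gamma_generators_subset_Isom)

lemma Gamma_subset_Isom: "Gamma_u n R \<iota> u \<tau> \<subseteq> Isom"
  using subgroup.subset[OF subgroup_Gamma] by simp

lemma Gamma_preserves_lattice:
  assumes "f \<in> Gamma_u n R \<iota> u \<tau>" "v \<in> lorentz_lattice \<Lambda>"
  shows "blinfun_apply (lorentz_rep f) v \<in> lorentz_lattice \<Lambda>"
  using assms unfolding Gamma_u_def
proof (induction arbitrary: v rule: generate.induct)
  case one
  then show ?case
    by (simp add: lorentz_rep_one)
next
  case (incl f)
  from incl(1) show ?case
    by (cases rule: Gamma_generators_cases)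
      (simp_all add: lorentz_rep_translation lorentz_rep_inversion incl(2)
        translation_preserves_lattice inversion_preserves_lattice)
next
  case (inv f)
  from inv(1) show ?case
  proof (cases rule: Gamma_generators_cases)
    case (translation h)
    then show ?thesis
      using translation_preserves_lattice[of "- h" v] diff[OF zero, of h] inv(2)
      by (simp add: inv_translation lorentz_rep_translation)
  next
    case (inversion c)
    then show ?thesis
      using inversion_preserves_lattice inv(2) by (simp add: inv_inversion lorentz_rep_inversion)
  qed
next
  case (eng f g)
  then have "f \<in> Isom" "g \<in> Isom"
    using Gamma_subset_Isom unfolding Gamma_u_def by auto
  then show ?case
    using eng by (simp add: lorentz_rep_mult)
qed

lemma discrete_Gamma: "discrete_subgroup (Gamma_u n R \<iota> u \<tau>)"
  unfolding discrete_subgroup_def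
  by (intro conjI subgroup_Gamma discrete_if_preserves_lattice) (auto intro: Gamma_preserves_lattice)

definition e :: 'a where
  "e = (1 / norm u0) *\<^sub>R u0"

lemma orthogonal_e_iff: "h \<bullet> e = 0 \<longleftrightarrow> h \<bullet> u0 = 0"
  using u(2) u0 linear_0[OF linear_\<iota>] by (auto simp: e_def)

lemma O_plus_subset_hull: "O_plus \<subseteq> polynomial_hull (lorentz_rep ` Gamma_u n R \<iota> u \<tau>)"
proof -
  let ?X = "lorentz_rep ` Gamma_u n R \<iota> u \<tau>"
  let ?G = "polynomial_hull ?X"
  have u0_nz: "u0 \<noteq> 0"
    using u(2) u0 linear_0[OF linear_\<iota>] by auto
  have compX: "g o\<^sub>L h \<in> ?X" if "g \<in> ?X" "h \<in> ?X" for g h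
  proof -
    obtain f k where "f \<in> Gamma_u n R \<iota> u \<tau>" "k \<in> Gamma_u n R \<iota> u \<tau>" "g = lorentz_rep f" "h = lorentz_rep k"
      using \<open>g \<in> ?X\<close> \<open>h \<in> ?X\<close> by blast
    then show ?thesis
      using subgroup.m_closed[OF subgroup_Gamma, of f k] Gamma_subset_Isom lorentz_rep_mult
      by (metis image_eqI subsetD)
  qed
  have oneX: "id_blinfun \<in> ?X"
    using subgroup.one_closed[OF subgroup_Gamma] lorentz_rep_one by (metis image_eqI)
  note comp = blinfun_compose_polynomial_hull[OF compX]
  have gen: "lorentz_rep f \<in> ?X" if "f \<in> Gamma_u_generators n R \<iota> u \<tau>" for f
    using that unfolding Gamma_u_def by (blast intro: generate.incl)
  have trans: "lorentz_translation h \<in> ?G" if "h \<bullet> e = 0" for h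
  proof (rule lorentz_translation_polynomial_hull[where S = \<Lambda>0, OF compX oneX])
    show "lorentz_translation h \<in> ?X" if "h \<in> \<Lambda>0" for h
    proof -
      have "translation h \<in> Gamma_u_generators n R \<iota> u \<tau>"
        using that unfolding Gamma_u_generators_def \<Lambda>0_def by blast
      then show ?thesis
        using gen lorentz_rep_translation by metis
    qed
    show "h \<in> span \<Lambda>0"
      using span_\<Lambda>0 that orthogonal_e_iff by blast
  qed
  have sphere: "reflection (unit_sphere_vector (c + h)) \<in> ?G"
    if "inversion c \<in> Gamma_u_generators n R \<iota> u \<tau>" "h \<bullet> e = 0" for c h
  proof -
    have "reflection (unit_sphere_vector c) \<in> ?G"
      using gen[OF that(1)] subset_polynomial_hull by (metis lorentz_rep_inversion subsetD)
    then have "lorentz_translation h o\<^sub>L reflection (unit_sphere_vector c) o\<^sub>L lorentz_translation (- h) \<in> ?G"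
      using comp trans that(2) by simp
    then show ?thesis
      by (simp add: lorentz_translation_unit_sphere_vector[symmetric] reflection_lorentz_translation)
  qed
  have zero_mem: "0 \<in> plus_part n R" "0 \<in> hyperplane n R u"
    using plus_part_eq zero_in_group_closure by (metis, simp add: hyperplane_def real_plus_part_def span_zero)
  have inv0: "inversion 0 \<in> Gamma_u_generators n R \<iota> u \<tau>"
    using zero_mem linear_0[OF linear_\<iota>] unfolding Gamma_u_generators_def by auto
  have "\<tau> \<in> plus_part n R \<inter> (\<lambda>x. x + \<tau>) ` hyperplane n R u"
    using zero_mem(2) \<tau> by (auto simp: complementary_vector_def intro: image_eqI[of _ _ 0])
  then have inv\<tau>: "inversion \<tau>0 \<in> Gamma_u_generators n R \<iota> u \<tau>"
    unfolding Gamma_u_generators_def by (intro UnI2 CollectI exI[of _ \<tau>0]) (simp add: \<tau>0)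
  \<comment> \<open>The height of the second family of centers; it is nonzero because \<tau> lies in
    the interior side of the hyperplane.\<close>
  define s where "s = \<tau>0 \<bullet> e"
  have ee: "e \<bullet> e = 1"
    using u0_nz by (simp add: e_def power2_norm_eq_inner[symmetric] power2_eq_square)
  have "\<tau>0 \<bullet> u0 > 0"
    using \<tau> inner_\<iota>[of \<tau>0 u0] by (simp add: \<tau>0 u0 complementary_vector_def hyperplane_interior_def)
  then have s: "s \<noteq> 0"
    using u0_nz by (simp add: s_def e_def)
  obtain f where f: "\<iota> f = qone"
    using qone_in_plus_part[OF ring] plus_part_subset_range by (metis rangeE subsetD)
  have ff: "f \<bullet> f = 1"
    using inner_\<iota>[of f f] by (simp add: f qone_def)
  have "qone \<bullet> u = 0"
    using u(3) by (simp add: qone_def qRe_def inner_prod_def inner_complex_def)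
  then have fe: "f \<bullet> e = 0"
    using inner_\<iota>[of f u0] by (simp add: orthogonal_e_iff f u0)
  interpret hyperplane_reflections ?G e f s
  proof
    show "id_blinfun \<in> ?G"
      by (rule subsetD[OF subset_polynomial_hull oneX])
    show "reflection (unit_sphere_vector h) \<in> ?G" if "h \<bullet> e = 0" for h
      using sphere[OF inv0 that] by simp
    show "reflection (unit_sphere_vector (s *\<^sub>R e + h)) \<in> ?G" if "h \<bullet> e = 0" for h
    proof -
      \<comment> \<open>The wanted center has the same height as \<open>\<tau>0\<close>, so a
        horizontal translation connects them.\<close>
      have "(s *\<^sub>R e + h - \<tau>0) \<bullet> e = 0"
        using that by (simp add: inner_diff_left inner_add_left ee s_def)
      from sphere[OF inv\<tau> this] show ?thesis
        by simp
    qed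
  qed (use comp trans ee ff fe s in auto)
  show ?thesis
    by (rule O_plus_subset)
qed

end

theorem theorem5p4:
  fixes n :: nat and R :: "quat set" and \<iota> :: "'a::euclidean_space \<Rightarrow> quat" and u \<tau> :: quat
  assumes "n \<in> {3, 4, 5}"
    and "DIM('a) = n - 1"
    and "admissible_ring n R"
    and "boundary_identification n R \<iota>"
    and "normalized_covering_vector n R u"
    and "nrm u > 3"
    and "complementary_vector n R u \<tau>"
  shows "zariski_closure (Gamma_u n R \<iota> u \<tau>) = Isom \<and>
    discrete_subgroup (Gamma_u n R \<iota> u \<tau>) \<and>
    (infinite_covolume (Gamma_u n R \<iota> u \<tau>) \<longrightarrow> thin_group (Gamma_u n R \<iota> u \<tau>))"
proof -
  have "u \<in> plus_part n R" "u \<noteq> 0" "qRe u = 0"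
    using assms(5) by (simp_all add: normalized_covering_vector_def covering_vector_def)
  then interpret covering_setup n R \<iota> u \<tau>
    using assms(3,4,7) by (intro covering_setup.intro)
  have "zariski_closure (Gamma_u n R \<iota> u \<tau>) = Isom"
    by (rule zariski_closure_eq_Isom[OF Gamma_subset_Isom O_plus_subset_hull])
  then show ?thesis
    using discrete_Gamma by (simp add: thin_group_def)
qed

end
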